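(* Let $Z,Z_1,Z_2,\ldots$ be i.i.d. nonnegative nondegenerate random variables with $\mathbb E Z=1$, and let $d=d(n)\in\{1,\ldots,n\}$ for each $n\in\mathbb N$. Let \[S_n^{(d)}=\sum_{1\leqslant i_1<\ldots<i_d\leqslant n}Z_{i_1}\cdots Z_{i_d},\qquad S_n=S_n^{(1)}=\sum_{k=1}^nZ_k.\] Then the following are equivalent as $n\to\infty$: (i) $S_n^{(d)}/\binom{n}{d}\to1$ in probability; (ii) $d(S_n/n-1)\to0$ in probability; (iii) $d\,\mathbb E Z\mathbf 1(dZ>n)\to0$ and $d^2\,\mathbb E Z^2\mathbf 1(dZ\leqslant n)=o(n)$.
   Context: $\mathbf 1(\cdot)$ denotes the indicator function. A random variable is nondegenerate if it is not almost surely equal to a constant. *)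

theory Defs
  imports "HOL-Probability.Probability"
begin

definition iid :: "'a measure \<Rightarrow> 'b measure \<Rightarrow> ('i \<Rightarrow> 'a \<Rightarrow> 'b) \<Rightarrow> 'i set \<Rightarrow> bool" where
  "iid M N X I \<longleftrightarrow>
     prob_space.indep_vars M (\<lambda>_. N) X I \<and>
     (\<forall>i\<in>I. \<forall>j\<in>I. distr M N (X i) = distr M N (X j))"

definition nondegenerate :: "'a measure \<Rightarrow> ('a \<Rightarrow> real) \<Rightarrow> bool" where
  "nondegenerate M X \<longleftrightarrow> \<not> (\<exists>c. AE x in M. X x = c)"

definition tendsto_in_prob :: "'a measure \<Rightarrow> (nat \<Rightarrow> 'a \<Rightarrow> real) \<Rightarrow> real \<Rightarrow> bool" where
  "tendsto_in_prob M X c \<longleftrightarrow>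
     (\<forall>\<epsilon>>0. (\<lambda>n. measure M {x \<in> space M. \<bar>X n x - c\<bar> > \<epsilon>}) \<longlonglongrightarrow> 0)"

(* Strictly increasing index tuples i_1 < ... < i_d in {1..n} are encoded as the
   d-element subsets of {1..n}. *)
definition esym_sum :: "(nat \<Rightarrow> 'a \<Rightarrow> real) \<Rightarrow> nat \<Rightarrow> nat \<Rightarrow> 'a \<Rightarrow> real" where
  "esym_sum Z d n x = (\<Sum>I | I \<subseteq> {1..n} \<and> card I = d. \<Prod>i\<in>I. Z i x)"

lemma esym_sum_1: "esym_sum Z 1 n x = (\<Sum>k=1..n. Z k x)"
proof -
  have "{I. I \<subseteq> {1..n} \<and> card I = 1} = (\<lambda>k. {k}) ` {1..n}"
    by (auto simp: card_1_singleton_iff)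
  then show ?thesis
    by (simp add: esym_sum_def sum.reindex)
qed

end

theory Submission
  imports Defs
begin

text \<open>
  With \<open>b = d / n\<close> the sum in (ii) is \<open>X = b (\<Sum>k\<le>n. (Z\<^sub>k - 1))\<close>. Maclaurin's inequality gives
  \<open>S\<^sub>n\<^sup>(\<^sup>d\<^sup>) / (n choose d) \<le> (S\<^sub>n / n)\<^sup>d \<le> exp X\<close>, so each of (i) and (ii) implies that the negative part
  of \<open>X\<close> tends to 0 in probability, and this one-sided statement already implies (iii): put
  \<open>\<phi> y = exp (- y) - 1 + y\<close> and \<open>p l = n E (\<phi> (l b (Z - 1)))\<close>. Then
  \<open>1 + p l \<le> E (exp (- l X)) \<le> exp (p l)\<close>. A bound on \<open>p (2 l)\<close> makes \<open>exp (- l X)\<close> bounded in \<open>L\<^sup>2\<close>,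
  hence uniformly integrable, so that \<open>p l\<close> is small; since \<open>\<phi> (2 y) \<le> 10 \<phi> y\<close> for \<open>y \<ge> - 1\<close>, the
  smallness climbs up the dyadic scales to \<open>l = 1\<close>. As \<open>\<phi> y\<close> is comparable to \<open>min (y\<^sup>2) \<bar>y\<bar>\<close>, the
  convergence \<open>p 1 \<longlonglongrightarrow> 0\<close> is (iii); nondegeneracy enters through \<open>d\<^sup>2 = o(n)\<close>.

  Conversely, given (iii), truncate \<open>Z\<close> at \<open>n / d\<close>. The first condition makes the truncation harmless in
  \<open>L\<^sup>1\<close>, and the second one gives convergence in \<open>L\<^sup>2\<close> after truncation, where the second moment of the
  symmetric sum is controlled by the sizes of the intersections of pairs of \<open>d\<close>-subsets.
\<close>

section \<open>Elementary symmetric polynomials\<close>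

text \<open>The polynomial of \<open>esym_sum\<close> over an arbitrary index set and arbitrary
  values: the induction for Maclaurin's inequality deletes an index, and later truncated variables
  are inserted.\<close>

definition elem_sym :: "'i set \<Rightarrow> ('i \<Rightarrow> real) \<Rightarrow> nat \<Rightarrow> real" where
  "elem_sym A x k = (\<Sum>I | I \<subseteq> A \<and> card I = k. \<Prod>i\<in>I. x i)"

lemma esym_sum_eq_elem_sym: "esym_sum Z k n \<omega> = elem_sym {1..n} (\<lambda>i. Z i \<omega>) k"
  by (simp add: esym_sum_def elem_sym_def)

lemma finite_card_subsets [simp]: "finite A \<Longrightarrow> finite {I. I \<subseteq> A \<and> card I = k}"
  by (rule finite_subset[of _ "Pow A"]) auto

lemma elem_sym_0 [simp]: "finite A \<Longrightarrow> elem_sym A x 0 = 1"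
proof -
  assume "finite A"
  then have "{I. I \<subseteq> A \<and> card I = 0} = {{}}"
    using finite_subset[of _ A] by (auto simp: card_eq_0_iff)
  then show ?thesis by (simp add: elem_sym_def)
qed

lemma elem_sym_mono:
  assumes "\<And>i. i \<in> A \<Longrightarrow> 0 \<le> x i" "\<And>i. i \<in> A \<Longrightarrow> x i \<le> y i"
  shows "elem_sym A x k \<le> elem_sym A y k"
  unfolding elem_sym_def using assms by (intro sum_mono prod_mono) auto

text \<open>Double counting of the pairs of a \<open>Suc k\<close>-subset \<open>I\<close> and a
  marked element \<open>i\<close> of it; \<open>(I, i)\<close> corresponds to
  \<open>(i, I - {i})\<close>.\<close>

lemma elem_sym_Suc:
  assumes A: "finite A"
  shows "real (Suc k) * elem_sym A x (Suc k) = (\<Sum>i\<in>A. x i * elem_sym (A - {i}) x k)"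
proof -
  let ?S = "{I. I \<subseteq> A \<and> card I = Suc k}"
  let ?T = "\<lambda>i. {J. J \<subseteq> A - {i} \<and> card J = k}"
  have fS: "finite ?S" using A by simp
  have fT: "\<forall>i\<in>A. finite (?T i)" using A by simp
  have fin: "finite I" if "I \<in> ?S" for I
    using that A finite_subset by auto
  have "real (Suc k) * elem_sym A x (Suc k) = (\<Sum>I\<in>?S. \<Sum>i\<in>I. \<Prod>j\<in>I. x j)"
    by (simp add: elem_sym_def sum_distrib_left)
  also have "\<dots> = (\<Sum>(I, i)\<in>(SIGMA I:?S. I). \<Prod>j\<in>I. x j)"
    by (rule sum.Sigma[of ?S "\<lambda>I. I" "\<lambda>I i. \<Prod>j\<in>I. x j"]) (use fS fin in blast)+
  also have "\<dots> = (\<Sum>(i, J)\<in>(SIGMA i:A. ?T i). x i * (\<Prod>j\<in>J. x j))"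
  proof (rule sum.reindex_bij_witness[where i = "\<lambda>(i, J). (insert i J, i)" and j = "\<lambda>(I, i). (i, I - {i})"])
    fix a assume "a \<in> (SIGMA I:?S. I)"
    then obtain I i where a: "a = (I, i)" "I \<subseteq> A" "card I = Suc k" "i \<in> I" by auto
    then have "finite I" using A finite_subset by auto
    then have p: "x i * (\<Prod>j\<in>I - {i}. x j) = (\<Prod>j\<in>I. x j)" using a by (simp add: prod.remove)
    show "(case case a of (I, i) \<Rightarrow> (i, I - {i}) of (i, J) \<Rightarrow> (insert i J, i)) = a"
      using a by auto
    show "(case a of (I, i) \<Rightarrow> (i, I - {i})) \<in> (SIGMA i:A. ?T i)"
      using a by auto
    show "(case case a of (I, i) \<Rightarrow> (i, I - {i}) of (i, J) \<Rightarrow> x i * (\<Prod>j\<in>J. x j))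
        = (case a of (I, i) \<Rightarrow> \<Prod>j\<in>I. x j)"
      using p by (simp add: a(1))
  next
    fix b assume "b \<in> (SIGMA i:A. ?T i)"
    then obtain i J where b: "b = (i, J)" "i \<in> A" "J \<subseteq> A - {i}" "card J = k" by auto
    then have "finite J" "i \<notin> J" using A finite_subset[of J A] by auto
    then show "(case case b of (i, J) \<Rightarrow> (insert i J, i) of (I, i) \<Rightarrow> (i, I - {i})) = b"
      "(case b of (i, J) \<Rightarrow> (insert i J, i)) \<in> (SIGMA I:?S. I)"
      using b by auto
  qed
  also have "\<dots> = (\<Sum>i\<in>A. \<Sum>J\<in>?T i. x i * (\<Prod>j\<in>J. x j))"
    by (rule sum.Sigma[symmetric, of A ?T "\<lambda>i J. x i * (\<Prod>j\<in>J. x j)"]) (fact A fT)+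
  finally show ?thesis by (simp add: elem_sym_def sum_distrib_left)
qed

section \<open>Maclaurin's inequality\<close>

text \<open>Weighted AM-GM for \<open>k\<close> copies of \<open>t ^ m\<close> and
  \<open>m - k\<close> copies of 1. Passing from \<open>m\<close> to \<open>m + 1\<close> costs only
  the inequality \<open>t ^ k - 1 \<le> k * t ^ m * (t - 1)\<close>, in which both sides have the
  sign of \<open>t - 1\<close>.\<close>

lemma power_le_chord:
  fixes t :: real
  assumes "0 \<le> t" "k \<le> m"
  shows "real m * t ^ k \<le> real k * t ^ m + real (m - k)"
  using assms(2)
proof (induction m rule: dec_induct)
  case base
  then show ?case by simp
next
  case (step m)
  have "t ^ k - 1 \<le> real k * t ^ m * (t - 1)"
  proof -
    have e: "t ^ k - 1 = (t - 1) * (\<Sum>i<k. t ^ i)"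
      by (simp add: power_diff_1_eq)
    show ?thesis
    proof (cases "1 \<le> t")
      case True
      have "(\<Sum>i<k. t ^ i) \<le> (\<Sum>i<k. t ^ m)"
        using True step by (intro sum_mono power_increasing) auto
      then show ?thesis using True e by (simp add: mult.commute mult_left_mono)
    next
      case False
      have "(\<Sum>i<k. t ^ m) \<le> (\<Sum>i<k. t ^ i)"
        using False assms step by (intro sum_mono power_decreasing) auto
      then show ?thesis using False e by (simp add: mult.commute mult_left_mono_neg)
    qed
  qed
  then show ?case using step by (simp add: algebra_simps of_nat_diff)
qed

text \<open>Normalized to mean 1: \<open>x\<close> is one of \<open>m + 1\<close> numbers and
  \<open>t\<close> is the mean of the others. AM-GM gives \<open>x * t ^ m \<le> 1\<close>, and the
  chord bound passes from exponent \<open>m\<close> to \<open>k\<close>. The right-hand side is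
  affine in \<open>x\<close>, so that summing over all numbers removes the term with
  \<open>x - 1\<close>.\<close>

lemma maclaurin_step:
  fixes x t :: real
  assumes "0 \<le> x" "0 \<le> t" "0 < m" "k \<le> m" and eq: "x + real m * t = real m + 1"
  shows "x * t ^ k \<le> 1 + (1 - real k / real m) * (x - 1)"
proof -
  \<comment> \<open>AM-GM by way of \<open>y \<le> exp (y - 1)\<close>: the constraint makes the
    exponents add up to 0.\<close>
  have "x * t ^ m \<le> exp (x - 1) * exp (t - 1) ^ m"
    using exp_ge_add_one_self[of "x - 1"] exp_ge_add_one_self[of "t - 1"] assms
    by (intro mult_mono power_mono) auto
  also have "\<dots> = exp (x - 1 + real m * (t - 1))"
    by (simp add: exp_add exp_of_nat_mult)
  also have "x - 1 + real m * (t - 1) = 0"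
    using eq by (simp add: algebra_simps)
  finally have 1: "x * t ^ m \<le> 1" by simp
  have "real m * (x * t ^ k) = x * (real m * t ^ k)" by simp
  also have "\<dots> \<le> x * (real k * t ^ m + real (m - k))"
    using assms by (intro mult_left_mono power_le_chord) auto
  also have "\<dots> = real k * (x * t ^ m) + real (m - k) * x" by (simp add: algebra_simps)
  also have "\<dots> \<le> real k * 1 + real (m - k) * x"
    using 1 by (intro add_mono mult_left_mono) auto
  also have "\<dots> = real m * (1 + (1 - real k / real m) * (x - 1))"
    using assms by (simp add: field_simps of_nat_diff)
  finally show ?thesis using \<open>0 < m\<close> by simp
qed

text \<open>Induction on the degree: \<open>elem_sym_Suc\<close> splits off one variable, the
  induction hypothesis bounds the rest by a power of the mean over \<open>A - {i}\<close>, and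
  \<open>maclaurin_step\<close> compares that mean with the mean over \<open>A\<close>.\<close>

theorem maclaurin_inequality:
  assumes "finite A" "\<And>i. i \<in> A \<Longrightarrow> 0 \<le> x i"
  shows "elem_sym A x k \<le> real (card A choose k) * (sum x A / real (card A)) ^ k"
  using assms
proof (induction k arbitrary: A)
  case 0
  then show ?case by simp
next
  case (Suc k)
  show ?case
  proof (cases "Suc k \<le> card A")
    case False
    then have "card I \<noteq> Suc k" if "I \<subseteq> A" for I
      using card_mono[OF Suc.prems(1) that] by auto
    then have "elem_sym A x (Suc k) = 0"
      unfolding elem_sym_def by (intro sum.neutral) auto
    then show ?thesis using Suc.prems(2) by (simp add: sum_nonneg del: power_Suc)
  next
    case True
    define m where "m = card A - 1"
    have cA: "card A = Suc m" using True by (simp add: m_def)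
    define \<mu> where "\<mu> = sum x A / real (card A)"
    have sx: "sum x A = (real m + 1) * \<mu>" by (simp add: \<mu>_def cA divide_simps)
    have \<mu>0: "0 \<le> \<mu>" using Suc.prems by (simp add: \<mu>_def sum_nonneg)
    \<comment> \<open>This is \<open>maclaurin_step\<close> after division by \<open>\<mu>\<close>.
      If \<open>m = 0\<close>, then \<open>k = 0\<close>, and \<open>real k / real m\<close> is 0 by
      the convention for division.\<close>
    have pt: "x i * (sum x (A - {i}) / real m) ^ k \<le> \<mu> ^ k * (\<mu> + (1 - real k / real m) * (x i - \<mu>))"
      if i: "i \<in> A" for i
    proof (cases "m = 0 \<or> \<mu> = 0")
      case True
      then show ?thesis
      proof
        assume "m = 0"
        then show ?thesis using \<open>Suc k \<le> card A\<close> cA by simp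
      next
        assume "\<mu> = 0"
        then have "sum x A = 0" by (simp add: sx)
        then have "x i = 0" using Suc.prems i by (simp add: sum_nonneg_eq_0_iff)
        then show ?thesis using \<open>\<mu> = 0\<close> by simp
      qed
    next
      case False
      then have "m > 0" "\<mu> > 0" using \<mu>0 by auto
      let ?t = "sum x (A - {i}) / real m"
      have s: "x i + sum x (A - {i}) = (real m + 1) * \<mu>"
        using sum.remove[OF Suc.prems(1) i, of x] sx by simp
      have "x i / \<mu> * (?t / \<mu>) ^ k \<le> 1 + (1 - real k / real m) * (x i / \<mu> - 1)"
      proof (rule maclaurin_step)
        show "x i / \<mu> + real m * (?t / \<mu>) = real m + 1"
          using s \<open>m > 0\<close> \<open>\<mu> > 0\<close> by (simp add: divide_simps)
      qed (use Suc.prems i True \<open>m > 0\<close> \<open>\<mu> > 0\<close> cA \<open>Suc k \<le> card A\<close> in \<open>auto intro!: sum_nonneg divide_nonneg_nonneg\<close>)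
      then have "\<mu> ^ Suc k * (x i / \<mu> * (?t / \<mu>) ^ k)
          \<le> \<mu> ^ Suc k * (1 + (1 - real k / real m) * (x i / \<mu> - 1))"
        using \<mu>0 by (intro mult_left_mono) auto
      moreover have "\<mu> ^ Suc k * (x i / \<mu> * (?t / \<mu>) ^ k) = x i * ?t ^ k"
        using \<open>\<mu> > 0\<close> by (simp add: power_divide power_mult_distrib)
      moreover have "\<mu> ^ Suc k * (1 + (1 - real k / real m) * (x i / \<mu> - 1))
          = \<mu> ^ k * (\<mu> + (1 - real k / real m) * (\<mu> * (x i / \<mu> - 1)))"
        by (simp add: algebra_simps)
      moreover have "\<mu> * (x i / \<mu> - 1) = x i - \<mu>"
        using \<open>\<mu> > 0\<close> by (simp add: field_simps)
      ultimately show ?thesis by metis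
    qed
    have IH: "elem_sym (A - {i}) x k \<le> real (m choose k) * (sum x (A - {i}) / real m) ^ k" if "i \<in> A" for i
    proof -
      have "card (A - {i}) = m" using that cA by (simp add: card_Diff_singleton)
      then show ?thesis using Suc.IH[of "A - {i}"] Suc.prems by simp
    qed
    have "real (Suc k) * elem_sym A x (Suc k) = (\<Sum>i\<in>A. x i * elem_sym (A - {i}) x k)"
      by (rule elem_sym_Suc) fact
    also have "\<dots> \<le> (\<Sum>i\<in>A. x i * (real (m choose k) * (sum x (A - {i}) / real m) ^ k))"
      using Suc.prems IH by (intro sum_mono mult_left_mono) auto
    also have "\<dots> = real (m choose k) * (\<Sum>i\<in>A. x i * (sum x (A - {i}) / real m) ^ k)"
      by (simp add: sum_distrib_left mult_ac)
    also have "\<dots> \<le> real (m choose k) * (\<Sum>i\<in>A. \<mu> ^ k * (\<mu> + (1 - real k / real m) * (x i - \<mu>)))"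
      using pt by (intro mult_left_mono sum_mono) auto
    also have "(\<Sum>i\<in>A. \<mu> ^ k * (\<mu> + (1 - real k / real m) * (x i - \<mu>)))
        = \<mu> ^ k * ((real m + 1) * \<mu> + (1 - real k / real m) * (sum x A - (real m + 1) * \<mu>))"
      by (simp add: sum_distrib_left[symmetric] sum.distrib sum_subtractf cA add.commute)
    \<comment> \<open>The deviations \<open>x i - \<mu>\<close> sum to 0, so only the constant part
      of the affine bound survives.\<close>
    also have "\<dots> = real (Suc m) * \<mu> ^ Suc k" by (simp add: sx)
    also have "real (m choose k) * (real (Suc m) * \<mu> ^ Suc k)
        = real (Suc k) * (real (Suc m choose Suc k) * \<mu> ^ Suc k)"
    proof -
      have "real (Suc m) * real (m choose k) = real (Suc k) * real (Suc m choose Suc k)"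
        using Suc_times_binomial[of k m] by (metis of_nat_mult)
      then show ?thesis by (metis mult.assoc mult.commute)
    qed
    finally show ?thesis unfolding cA[symmetric] \<mu>_def
      by (rule mult_left_le_imp_le) simp
  qed
qed

section \<open>Intersections of pairs of subsets\<close>

text \<open>The quotient of the two binomial coefficients is the product of
  \<open>(k - i) / (n - i)\<close> over \<open>i < j\<close>, and each factor is at most
  \<open>k / n\<close>.\<close>

lemma binomial_diff_le:
  assumes "j \<le> k" "k \<le> n"
  shows "real ((n - j) choose (k - j)) \<le> real (n choose k) * (real k / real n) ^ j"
  using assms(1)
proof (induction j)
  case 0
  then show ?case by simp
next
  case (Suc j)
  define N K where "N = n - Suc j" and "K = k - Suc j"
  have N: "n - j = Suc N" and K: "k - j = Suc K" using Suc.prems assms by (auto simp: N_def K_def)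
  have "real (N choose K) = real (Suc N choose Suc K) * (real (Suc K) / real (Suc N))"
    using Suc_times_binomial[of K N, THEN arg_cong[where f = real]] unfolding of_nat_mult
    by (simp add: field_simps)
  also have "\<dots> \<le> (real (n choose k) * (real k / real n) ^ j) * (real k / real n)"
  proof (intro mult_mono)
    show "real (Suc N choose Suc K) \<le> real (n choose k) * (real k / real n) ^ j"
      using Suc N K by simp
    have "real (Suc K) = real k - real j" "real (Suc N) = real n - real j"
      using N K Suc.prems assms by linarith+
    moreover have "0 < real n - real j" using N by linarith
    moreover have "real j * real k \<le> real j * real n" using assms by (intro mult_left_mono) auto
    then have "(real k - real j) * real n \<le> real k * (real n - real j)" by (simp add: algebra_simps)
    ultimately show "real (Suc K) / real (Suc N) \<le> real k / real n"
      using assms by (simp add: divide_simps del: of_nat_Suc)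
  qed auto
  finally show ?case by (simp add: N_def K_def mult_ac)
qed

lemma sum_power_card_Pow:
  fixes s :: real
  assumes "finite B"
  shows "(\<Sum>X\<in>Pow B. s ^ card X) = (1 + s) ^ card B"
  using prod_add[OF assms, of "\<lambda>_. s" "\<lambda>_. 1"] by (simp add: add.commute)

lemma card_subsets_containing:
  assumes "finite A" "X \<subseteq> A" "card X \<le> k"
  shows "card {J. J \<subseteq> A \<and> card J = k \<and> X \<subseteq> J} = (card A - card X) choose (k - card X)"
proof -
  have fX: "finite X" using assms finite_subset by auto
  have "bij_betw (\<lambda>J. J - X) {J. J \<subseteq> A \<and> card J = k \<and> X \<subseteq> J} {J. J \<subseteq> A - X \<and> card J = k - card X}"
  proof (rule bij_betw_byWitness[where f' = "\<lambda>J. J \<union> X"])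
    show "(\<lambda>J. J \<union> X) ` {J. J \<subseteq> A - X \<and> card J = k - card X} \<subseteq> {J. J \<subseteq> A \<and> card J = k \<and> X \<subseteq> J}"
    proof safe
      fix J assume J: "J \<subseteq> A - X" "card J = k - card X"
      have "card (J \<union> X) = card J + card X"
        using J fX assms by (intro card_Un_disjoint) (auto intro: finite_subset)
      then show "card (J \<union> X) = k" using J assms by simp
    qed (use assms in auto)
  qed (auto simp: card_Diff_subset fX)
  then have "card {J. J \<subseteq> A \<and> card J = k \<and> X \<subseteq> J} = card {J. J \<subseteq> A - X \<and> card J = k - card X}"
    by (rule bij_betw_same_card)
  then show ?thesis using assms fX by (simp add: n_subsets card_Diff_subset)
qed

text \<open>For a uniformly random \<open>k\<close>-subset \<open>J\<close>, the size of
  \<open>I \<inter> J\<close> is hypergeometric; its generating function is bounded by that of a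
  binomial variable with \<open>k\<close> trials and success probability \<open>k / card A\<close>.
  The power is expanded over the subsets \<open>X\<close> of \<open>I \<inter> J\<close>, and after
  swapping the sums the sets \<open>J\<close> that contain \<open>X\<close> are counted.\<close>

lemma sum_power_card_Int_le:
  fixes s :: real
  assumes A: "finite A" and I: "I \<subseteq> A" "card I = k" and s: "0 \<le> s"
  shows "(\<Sum>J | J \<subseteq> A \<and> card J = k. (1 + s) ^ card (I \<inter> J))
    \<le> real (card A choose k) * (1 + s * real k / real (card A)) ^ k"
proof -
  let ?S = "{J. J \<subseteq> A \<and> card J = k}"
  have fI: "finite I" using A I finite_subset by auto
  have kn: "k \<le> card A" using A I card_mono by auto
  have "(\<Sum>J\<in>?S. (1 + s) ^ card (I \<inter> J)) = (\<Sum>J\<in>?S. \<Sum>X | X \<in> Pow I \<and> X \<subseteq> J. s ^ card X)"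
  proof (rule sum.cong[OF refl])
    fix J
    have "{X. X \<in> Pow I \<and> X \<subseteq> J} = Pow (I \<inter> J)" by auto
    then show "(1 + s) ^ card (I \<inter> J) = (\<Sum>X | X \<in> Pow I \<and> X \<subseteq> J. s ^ card X)"
      using sum_power_card_Pow[of "I \<inter> J" s] fI by simp
  qed
  also have "\<dots> = (\<Sum>X\<in>Pow I. \<Sum>J | J \<in> ?S \<and> X \<subseteq> J. s ^ card X)"
    using A fI by (intro sum.swap_restrict) auto
  also have "\<dots> = (\<Sum>X\<in>Pow I. s ^ card X * real ((card A - card X) choose (k - card X)))"
  proof (rule sum.cong[OF refl])
    fix X assume X: "X \<in> Pow I"
    have "card X \<le> k" using X I fI card_mono by auto
    then show "(\<Sum>J | J \<in> ?S \<and> X \<subseteq> J. s ^ card X) = s ^ card X * real ((card A - card X) choose (k - card X))"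
      using card_subsets_containing[of A X k] X I A by (auto simp: conj_assoc)
  qed
  also have "\<dots> \<le> (\<Sum>X\<in>Pow I. s ^ card X * (real (card A choose k) * (real k / real (card A)) ^ card X))"
    using s kn I fI by (intro sum_mono mult_left_mono binomial_diff_le) (auto intro: card_mono)
  also have "\<dots> = real (card A choose k) * (\<Sum>X\<in>Pow I. (s * real k / real (card A)) ^ card X)"
    by (simp add: sum_distrib_left power_mult_distrib power_divide mult_ac)
  also have "\<dots> = real (card A choose k) * (1 + s * real k / real (card A)) ^ k"
    using sum_power_card_Pow[OF fI] I by simp
  finally show ?thesis .
qed

section \<open>The second-order remainder of the exponential\<close>

text \<open>The function \<phi> of the overview. The linear term drops out in expectation at
  \<open>y = b * (Z - 1)\<close>, because \<open>Z\<close> has mean 1.\<close>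

definition exp_rem :: "real \<Rightarrow> real" where
  "exp_rem y = exp (- y) - 1 + y"

lemma exp_rem_nonneg: "0 \<le> exp_rem y"
  using exp_ge_add_one_self[of "- y"] by (simp add: exp_rem_def)

text \<open>Convexity together with the value 0 at the origin.\<close>

lemma exp_rem_scale:
  assumes "0 \<le> l" "l \<le> 1"
  shows "exp_rem (l * y) \<le> l * exp_rem y"
  using convex_onD[OF exp_convex, of l 0 "- y"] assms
  by (simp add: exp_rem_def algebra_simps)

lemma exp_rem_ge_nonpos:
  assumes "y \<le> 0"
  shows "y\<^sup>2 / 2 \<le> exp_rem y"
  using exp_lower_Taylor_quadratic[of "- y"] assms by (simp add: exp_rem_def)

text \<open>Both sides vanish at 0, and the derivative of their difference is the square
  \<open>(1 - exp (- x))\<^sup>2\<close>.\<close>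

lemma exp_rem_ge_nonneg:
  assumes "0 \<le> y"
  shows "(1 - exp (- y))\<^sup>2 / 2 \<le> exp_rem y"
proof -
  define f where "f = (\<lambda>y::real. exp_rem y - (1 - exp (- y))\<^sup>2 / 2)"
  have "f 0 \<le> f y"
  proof (rule DERIV_nonneg_imp_nondecreasing[OF assms])
    fix x :: real
    have "(f has_real_derivative (1 - exp (- x) - (1 - exp (- x)) * exp (- x))) (at x)"
      unfolding f_def exp_rem_def
      by (auto intro!: derivative_eq_intros)
    then have "(f has_real_derivative (1 - exp (- x))\<^sup>2) (at x)"
      by (simp add: power2_eq_square algebra_simps)
    then show "\<exists>y. DERIV f x :> y \<and> 0 \<le> y" by auto
  qed
  then show ?thesis by (simp add: f_def exp_rem_def)
qed

text \<open>On the unit interval \<open>exp (- y) \<le> 1 - y / 2\<close>, which is inserted into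
  \<open>exp_rem_ge_nonneg\<close>.\<close>

lemma exp_rem_ge_unit:
  assumes "0 \<le> y" "y \<le> 1"
  shows "y\<^sup>2 / 8 \<le> exp_rem y"
proof -
  have "(1 - y / 2) * exp y \<ge> (1 - y / 2) * (1 + y)"
    using assms exp_ge_add_one_self[of y] by (intro mult_left_mono) auto
  moreover have "(1 - y / 2) * (1 + y) = 1 + y * (1 - y) / 2" by (simp add: algebra_simps add_divide_distrib diff_divide_distrib)
  moreover have "0 \<le> y * (1 - y)" using assms by simp
  ultimately have "1 \<le> (1 - y / 2) * exp y" by linarith
  then have "exp (- y) \<le> 1 - y / 2" by (simp add: exp_minus divide_simps mult.commute)
  then have "(y / 2)\<^sup>2 \<le> (1 - exp (- y))\<^sup>2" using assms by (intro power_mono) auto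
  then show ?thesis using exp_rem_ge_nonneg[OF assms(1)] by (simp add: power_divide)
qed

text \<open>Linear growth from convexity: \<open>y\<close> is scaled down to \<open>1 / 2\<close>,
  where the quadratic bound gives \<open>1 / 32\<close>.\<close>

lemma exp_rem_ge_large:
  assumes "1 / 2 \<le> y"
  shows "y / 16 \<le> exp_rem y"
proof -
  have "1 / 32 \<le> exp_rem (1 / (2 * y) * y)"
    using exp_rem_ge_unit[of "1 / 2"] assms by (simp add: power2_eq_square)
  also have "\<dots> \<le> 1 / (2 * y) * exp_rem y"
    using assms by (intro exp_rem_scale) auto
  finally show ?thesis using assms by (simp add: field_simps)
qed

text \<open>The constant is 2 + 8, from the identity
  \<open>exp_rem (2 * y) = (1 - exp (- y))\<^sup>2 + 2 * exp_rem y\<close> and the bound of the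
  square by \<open>8 * exp_rem y\<close>. A lower bound on \<open>y\<close> is essential, since
  \<open>exp_rem\<close> grows exponentially at minus infinity.\<close>

lemma exp_rem_double:
  assumes "- 1 \<le> y"
  shows "exp_rem (2 * y) \<le> 10 * exp_rem y"
proof -
  have "exp (- (2 * y)) = (exp (- y))\<^sup>2"
    by (simp add: power2_eq_square flip: exp_add)
  then have e: "exp_rem (2 * y) = (1 - exp (- y))\<^sup>2 + 2 * exp_rem y"
    by (simp add: exp_rem_def power2_eq_square algebra_simps)
  have "(1 - exp (- y))\<^sup>2 \<le> 8 * exp_rem y"
  proof (cases "0 \<le> y")
    case True
    then show ?thesis using exp_rem_ge_nonneg[OF True] exp_rem_nonneg[of y] by simp
  next
    case False
    then have "exp (- y) \<le> 1 + (- y) + (- y)\<^sup>2"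
      using exp_bound[of "- y"] assms by simp
    moreover have "(- y)\<^sup>2 \<le> - y"
      using False assms mult_left_mono[of "- y" 1 "- y"] by (simp add: power2_eq_square)
    ultimately have "exp (- y) - 1 \<le> 2 * (- y)" by simp
    moreover have "0 \<le> exp (- y) - 1" using False by simp
    ultimately have "(exp (- y) - 1)\<^sup>2 \<le> (2 * (- y))\<^sup>2" by (intro power_mono)
    then show ?thesis using exp_rem_ge_nonpos[of y] False by (simp add: power2_commute)
  qed
  then show ?thesis using e by simp
qed

section \<open>Lower tails of the scaled sums\<close>

text \<open>\<open>U n\<close> stands for a truncated version of \<open>X n\<close>: Markov's
  inequality controls \<open>X n - U n\<close> in mean, and Chebyshev's inequality controls
  \<open>U n - c\<close> in mean square.\<close>

lemma (in prob_space) tendsto_in_probI: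
  fixes X U :: "nat \<Rightarrow> 'a \<Rightarrow> real"
  assumes [measurable]: "\<And>n. X n \<in> borel_measurable M" "\<And>n. U n \<in> borel_measurable M"
    and int1: "\<And>n. n \<ge> 1 \<Longrightarrow> integrable M (\<lambda>x. \<bar>X n x - U n x\<bar>)"
    and int2: "\<And>n. n \<ge> 1 \<Longrightarrow> integrable M (\<lambda>x. (U n x - c)\<^sup>2)"
    and le1: "\<And>n. n \<ge> 1 \<Longrightarrow> expectation (\<lambda>x. \<bar>X n x - U n x\<bar>) \<le> f n"
    and le2: "\<And>n. n \<ge> 1 \<Longrightarrow> expectation (\<lambda>x. (U n x - c)\<^sup>2) \<le> g n"
    and f: "f \<longlonglongrightarrow> 0" and g: "g \<longlonglongrightarrow> 0"
  shows "tendsto_in_prob M X c"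
  unfolding tendsto_in_prob_def
proof (intro allI impI)
  fix \<epsilon> :: real assume \<epsilon>: "0 < \<epsilon>"
  have le: "prob {x \<in> space M. \<bar>X n x - c\<bar> > \<epsilon>} \<le> f n / (\<epsilon> / 2) + g n / (\<epsilon> / 2)\<^sup>2" if n: "n \<ge> 1" for n
  proof -
    let ?A = "{x \<in> space M. \<bar>X n x - U n x\<bar> \<ge> \<epsilon> / 2}" and ?B = "{x \<in> space M. \<bar>U n x - c\<bar> \<ge> \<epsilon> / 2}"
    have "prob {x \<in> space M. \<bar>X n x - c\<bar> > \<epsilon>} \<le> prob (?A \<union> ?B)"
    proof (rule finite_measure_mono)
      have "\<bar>X n x - c\<bar> \<le> \<bar>X n x - U n x\<bar> + \<bar>U n x - c\<bar>" for x by arith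
      then have "\<epsilon> / 2 \<le> \<bar>X n x - U n x\<bar> \<or> \<epsilon> / 2 \<le> \<bar>U n x - c\<bar>" if "\<epsilon> < \<bar>X n x - c\<bar>" for x
        using that by (smt (verit) field_sum_of_halves)
      then show "{x \<in> space M. \<bar>X n x - c\<bar> > \<epsilon>} \<subseteq> ?A \<union> ?B" by blast
    qed measurable
    also have "\<dots> \<le> prob ?A + prob ?B"
      by (rule measure_Un_le) auto
    also have "prob ?A \<le> expectation (\<lambda>x. \<bar>X n x - U n x\<bar>) / (\<epsilon> / 2)"
      using int1[OF n] \<epsilon> by (intro integral_Markov_inequality_measure[where A = "space M"]) auto
    also have "\<dots> \<le> f n / (\<epsilon> / 2)"
      using le1[OF n] \<epsilon> by (intro divide_right_mono) auto
    also have "prob ?B \<le> expectation (\<lambda>x. (U n x - c)\<^sup>2) / (\<epsilon> / 2)\<^sup>2"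
      using int2[OF n] \<epsilon> by (intro second_moment_method) auto
    also have "\<dots> \<le> g n / (\<epsilon> / 2)\<^sup>2"
      using le2[OF n] \<epsilon> by (intro divide_right_mono) auto
    finally show ?thesis by simp
  qed
  show "(\<lambda>n. prob {x \<in> space M. \<bar>X n x - c\<bar> > \<epsilon>}) \<longlonglongrightarrow> 0"
  proof (rule tendsto_sandwich[where f = "\<lambda>_. 0" and h = "\<lambda>n. f n / (\<epsilon> / 2) + g n / (\<epsilon> / 2)\<^sup>2"])
    have "(\<lambda>n. f n / (\<epsilon> / 2) + g n / (\<epsilon> / 2)\<^sup>2) \<longlonglongrightarrow> 0 / (\<epsilon> / 2) + 0 / (\<epsilon> / 2)\<^sup>2"
      using \<epsilon> by (intro tendsto_intros f g) auto
    then show "(\<lambda>n. f n / (\<epsilon> / 2) + g n / (\<epsilon> / 2)\<^sup>2) \<longlonglongrightarrow> 0" by simp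
    show "\<forall>\<^sub>F n in sequentially. prob {x \<in> space M. \<bar>X n x - c\<bar> > \<epsilon>} \<le> f n / (\<epsilon> / 2) + g n / (\<epsilon> / 2)\<^sup>2"
      by (rule eventually_sequentiallyI[of 1]) (rule le)
  qed auto
qed

section \<open>Exponential moments of the centred sums\<close>

locale iid_unit_mean= prob_space M for M :: "'a measure" +
  fixes Z :: "nat \<Rightarrow> 'a \<Rightarrow> real"
  assumes iid: "iid M borel Z UNIV"
    and Z_nonneg: "\<And>k. AE x in M. 0 \<le> Z k x"
    and Z_nondegenerate: "nondegenerate M (Z 0)"
    and Z_integrable: "integrable M (Z 0)"
    and Z_mean: "expectation (Z 0) = 1"
begin

lemma Z_measurable [measurable]: "Z k \<in> borel_measurable M"
  using iid unfolding iid_def indep_vars_def by auto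

lemma
  assumes [measurable]: "f \<in> borel_measurable borel"
  shows expectation_Z: "expectation (\<lambda>x. f (Z k x) :: real) = expectation (\<lambda>x. f (Z 0 x))"
    and integrable_Z_iff: "integrable M (\<lambda>x. f (Z k x)) \<longleftrightarrow> integrable M (\<lambda>x. f (Z 0 x))"
proof -
  have d: "distr M borel (Z k) = distr M borel (Z 0)"
    using iid by (simp add: iid_def)
  show "expectation (\<lambda>x. f (Z k x)) = expectation (\<lambda>x. f (Z 0 x))"
    using arg_cong[OF d, of "\<lambda>N. integral\<^sup>L N f"] by (simp add: integral_distr)
  show "integrable M (\<lambda>x. f (Z k x)) \<longleftrightarrow> integrable M (\<lambda>x. f (Z 0 x))"
    using arg_cong[OF d, of "\<lambda>N. integrable N f"] by (simp add: integrable_distr_eq)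
qed

text \<open>The factor may depend on the index, because mixed second moments of symmetric sums
  contain squares at some indices and first powers at others.\<close>

lemma
  fixes f :: "nat \<Rightarrow> real \<Rightarrow> real"
  assumes "finite I" and [measurable]: "\<And>i. f i \<in> borel_measurable borel"
    and int: "\<And>i. i \<in> I \<Longrightarrow> integrable M (\<lambda>x. f i (Z 0 x))"
  shows expectation_prod_Z: "expectation (\<lambda>x. \<Prod>i\<in>I. f i (Z i x)) = (\<Prod>i\<in>I. expectation (\<lambda>x. f i (Z 0 x)))"
    and integrable_prod_Z: "integrable M (\<lambda>x. \<Prod>i\<in>I. f i (Z i x))"
proof -
  have ind: "indep_vars (\<lambda>_. borel) (\<lambda>i x. f i (Z i x)) I"
    by (rule indep_vars_compose2[OF indep_vars_subset[of "\<lambda>_. borel" Z UNIV I]])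
       (use iid in \<open>auto simp: iid_def\<close>)
  have int': "integrable M (\<lambda>x. f i (Z i x))" if "i \<in> I" for i
    using int[OF that] by (subst integrable_Z_iff) auto
  show "integrable M (\<lambda>x. \<Prod>i\<in>I. f i (Z i x))"
    by (rule indep_vars_integrable[OF assms(1) ind int'])
  have "expectation (\<lambda>x. \<Prod>i\<in>I. f i (Z i x)) = (\<Prod>i\<in>I. expectation (\<lambda>x. f i (Z i x)))"
    by (rule indep_vars_lebesgue_integral[OF assms(1) ind int'])
  also have "\<dots> = (\<Prod>i\<in>I. expectation (\<lambda>x. f i (Z 0 x)))"
    by (intro prod.cong refl expectation_Z) auto
  finally show "expectation (\<lambda>x. \<Prod>i\<in>I. f i (Z i x)) = (\<Prod>i\<in>I. expectation (\<lambda>x. f i (Z 0 x)))" .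
qed

text \<open>By \<open>expectation_exp_Z\<close>, for \<open>b \<ge> 0\<close> this is the Laplace
  transform of \<open>Z - 1\<close> at \<open>b\<close>, minus 1. The quantity \<open>p l\<close> of
  the overview is \<open>n * laplace_excess (l * b)\<close> with \<open>b = d / n\<close>.\<close>

definition laplace_excess :: "real \<Rightarrow> real" where
  "laplace_excess b = expectation (\<lambda>x. exp_rem (b * (Z 0 x - 1)))"

lemma exp_rem_measurable [measurable]: "exp_rem \<in> borel_measurable borel"
  unfolding exp_rem_def[abs_def] by measurable

lemma integrable_exp_Z:
  assumes "0 \<le> b"
  shows "integrable M (\<lambda>x. exp (- (b * (Z 0 x - 1))))"
proof (rule integrable_const_bound[where B = "exp b"])
  show "AE x in M. norm (exp (- (b * (Z 0 x - 1)))) \<le> exp b"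
    using Z_nonneg[of 0]
  proof eventually_elim
    case (elim x)
    then have "0 \<le> b * Z 0 x" using assms by simp
    then show ?case by (simp add: algebra_simps)
  qed
qed measurable

lemma integrable_exp_rem_Z:
  assumes "0 \<le> b"
  shows "integrable M (\<lambda>x. exp_rem (b * (Z 0 x - 1)))"
  using integrable_exp_Z[OF assms] Z_integrable unfolding exp_rem_def by auto

lemma expectation_exp_Z:
  assumes "0 \<le> b"
  shows "expectation (\<lambda>x. exp (- (b * (Z 0 x - 1)))) = 1 + laplace_excess b"
proof -
  have "laplace_excess b = expectation (\<lambda>x. exp (- (b * (Z 0 x - 1)))) - 1"
    unfolding laplace_excess_def exp_rem_def using integrable_exp_Z[OF assms] Z_integrable Z_mean
    by (simp add: prob_space)
  then show ?thesis by simp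
qed

lemma laplace_excess_nonneg: "0 \<le> laplace_excess b"
  unfolding laplace_excess_def by (intro integral_nonneg_AE) (auto simp: exp_rem_nonneg)

lemma laplace_excess_scale:
  assumes "0 \<le> l" "l \<le> 1" "0 \<le> b"
  shows "laplace_excess (l * b) \<le> l * laplace_excess b"
proof -
  have "laplace_excess (l * b) \<le> expectation (\<lambda>x. l * exp_rem (b * (Z 0 x - 1)))"
    unfolding laplace_excess_def using assms integrable_exp_rem_Z[of "l * b"] integrable_exp_rem_Z[of b] exp_rem_scale[of l]
    by (intro integral_mono) (auto simp: mult.assoc)
  then show ?thesis by (simp add: laplace_excess_def)
qed

text \<open>Since \<open>Z \<ge> 0\<close> and \<open>b \<le> 1\<close>, the argument
  \<open>b * (Z - 1)\<close> is at least -1, as \<open>exp_rem_double\<close> demands.\<close>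

lemma laplace_excess_double:
  assumes "0 \<le> b" "b \<le> 1"
  shows "laplace_excess (2 * b) \<le> 10 * laplace_excess b"
proof -
  have "laplace_excess (2 * b) \<le> expectation (\<lambda>x. 10 * exp_rem (b * (Z 0 x - 1)))"
    unfolding laplace_excess_def
  proof (rule integral_mono_AE)
    show "AE x in M. exp_rem (2 * b * (Z 0 x - 1)) \<le> 10 * exp_rem (b * (Z 0 x - 1))"
      using Z_nonneg[of 0]
    proof eventually_elim
      case (elim x)
      then have "0 \<le> b * Z 0 x" using assms by simp
      then have "- 1 \<le> b * (Z 0 x - 1)" using assms by (simp add: right_diff_distrib)
      from exp_rem_double[OF this] show ?case by (simp add: mult.assoc)
    qed
  qed (use assms integrable_exp_rem_Z[of "2 * b"] integrable_exp_rem_Z[of b] in auto)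
  then show ?thesis by (simp add: laplace_excess_def)
qed

lemma
  assumes "0 \<le> b"
  shows laplace_sum: "expectation (\<lambda>x. exp (- (b * (\<Sum>k=1..n. Z k x - 1)))) = (1 + laplace_excess b) ^ n"
    and integrable_exp_sum: "integrable M (\<lambda>x. exp (- (b * (\<Sum>k=1..n. Z k x - 1))))"
proof -
  have e: "exp (- (b * (\<Sum>k=1..n. Z k x - 1))) = (\<Prod>k=1..n. exp (- (b * (Z k x - 1))))" for x
    by (simp add: sum_distrib_left sum_negf[symmetric] exp_sum)
  note int = integrable_exp_Z[OF assms]
  show "integrable M (\<lambda>x. exp (- (b * (\<Sum>k=1..n. Z k x - 1))))"
    unfolding e by (rule integrable_prod_Z) (use int in auto)
  show "expectation (\<lambda>x. exp (- (b * (\<Sum>k=1..n. Z k x - 1)))) = (1 + laplace_excess b) ^ n"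
    unfolding e by (subst expectation_prod_Z) (use int in \<open>auto simp: expectation_exp_Z assms\<close>)
qed

text \<open>A quantitative form of uniform integrability. Off the event
  \<open>X < - \<epsilon>\<close>, \<open>exp (- X)\<close> is at most
  \<open>exp \<epsilon>\<close>; on it, AM-GM with parameter \<open>t\<close> separates the
  indicator from \<open>exp (- 2 * X)\<close>. The bound on
  \<open>n * laplace_excess (2 * b)\<close> keeps the expectation of the latter below
  \<open>exp 1\<close>.\<close>

lemma laplace_excess_le_lower_tail:
  assumes b: "0 \<le> b" and small: "real n * laplace_excess (2 * b) \<le> 1" and \<epsilon>: "0 < \<epsilon>" and t: "0 < t"
  shows "real n * laplace_excess b \<le> exp \<epsilon> - 1
    + t / 2 * prob {x \<in> space M. b * (\<Sum>k=1..n. Z k x - 1) < - \<epsilon>} + exp 1 / (2 * t)"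
proof -
  define X where "X = (\<lambda>x. b * (\<Sum>k=1..n. Z k x - 1))"
  have [measurable]: "X \<in> borel_measurable M" unfolding X_def by measurable
  let ?A = "{x \<in> space M. X x < - \<epsilon>}"
  have int1: "integrable M (\<lambda>x. exp (- X x))"
    unfolding X_def by (rule integrable_exp_sum[OF b])
  have e2: "- (2 * b * (\<Sum>k=1..n. Z k x - 1)) = - (2 * X x)" for x by (simp add: X_def)
  have int2: "integrable M (\<lambda>x. exp (- (2 * X x)))"
    using integrable_exp_sum[of "2 * b" n] b unfolding e2 by simp
  have intA: "integrable M (indicator ?A :: 'a \<Rightarrow> real)"
    by (rule integrable_real_indicator) (simp_all add: emeasure_eq_measure)
  have "1 + real n * laplace_excess b \<le> (1 + laplace_excess b) ^ n"
    by (rule Bernoulli_inequality) (use laplace_excess_nonneg[of b] in simp)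
  also have "\<dots> = expectation (\<lambda>x. exp (- X x))"
    unfolding X_def by (rule laplace_sum[OF b, symmetric])
  also have "\<dots> \<le> expectation (\<lambda>x. exp \<epsilon> + t / 2 * indicator ?A x + 1 / (2 * t) * exp (- (2 * X x)))"
  proof (rule integral_mono)
    fix x assume x: "x \<in> space M"
    have sq: "exp (- (2 * X x)) = (exp (- X x))\<^sup>2"
      by (simp add: power2_eq_square flip: exp_add)
    show "exp (- X x) \<le> exp \<epsilon> + t / 2 * indicator ?A x + 1 / (2 * t) * exp (- (2 * X x))"
    proof (cases "x \<in> ?A")
      case True
      have "0 \<le> (t - exp (- X x))\<^sup>2 / (2 * t)" using t by simp
      also have "\<dots> = t / 2 + 1 / (2 * t) * (exp (- X x))\<^sup>2 - exp (- X x)"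
        using t by (simp add: power2_diff field_simps power2_eq_square)
      finally show ?thesis using True exp_gt_zero[of \<epsilon>] by (simp add: sq del: exp_gt_zero)
    next
      case False
      then have "exp (- X x) \<le> exp \<epsilon>" using x by simp
      also have "\<dots> \<le> exp \<epsilon> + 1 / (2 * t) * exp (- (2 * X x))" using t by simp
      finally show ?thesis using False by simp
    qed
  qed (use int1 int2 intA in \<open>auto simp del: Bochner_Integration.integrable_add intro!: Bochner_Integration.integrable_add\<close>)
  also have "\<dots> = exp \<epsilon> + t / 2 * prob ?A + 1 / (2 * t) * expectation (\<lambda>x. exp (- (2 * X x)))"
    using int2 intA by (simp add: prob_space)
  also have "expectation (\<lambda>x. exp (- (2 * X x))) = (1 + laplace_excess (2 * b)) ^ n"
    using laplace_sum[of "2 * b" n] b unfolding e2 by simp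
  also have "\<dots> \<le> exp (laplace_excess (2 * b)) ^ n"
    using laplace_excess_nonneg[of "2 * b"] exp_ge_add_one_self by (intro power_mono) auto
  also have "\<dots> = exp (real n * laplace_excess (2 * b))" by (simp add: exp_of_nat_mult)
  also have "\<dots> \<le> exp 1" using small by simp
  finally show ?thesis using t by (simp add: X_def divide_right_mono)
qed

text \<open>The bound of the preceding lemma is propagated along the scales \<open>b / 2 ^ j\<close>, starting
  from a scale at which it holds trivially.\<close>

lemma laplace_excess_le_lower_tail_bootstrap:
  assumes b: "0 \<le> b" "b \<le> 1" and \<epsilon>: "0 < \<epsilon>" and t: "0 < t"
    and \<eta>: "exp \<epsilon> - 1 + t / 2 * prob {x \<in> space M. b * (\<Sum>k=1..n. Z k x - 1) < - \<epsilon>} + exp 1 / (2 * t) \<le> \<eta>"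
    and small: "100 * \<eta> \<le> 1"
  shows "real n * laplace_excess b \<le> 10 * \<eta>"
proof -
  \<comment> \<open>For \<open>c \<le> b\<close> the event at scale \<open>c / 2\<close> lies inside
    the event at scale \<open>b\<close>: the sum must be negative, and the larger factor pushes it
    lower. Hence a single \<open>\<eta>\<close> serves all scales.\<close>
  have half: "real n * laplace_excess (c / 2) \<le> \<eta>" if c: "0 \<le> c" "c \<le> b" and qc: "real n * laplace_excess c \<le> 1" for c
  proof -
    let ?S = "\<lambda>x. \<Sum>k=1..n. Z k x - 1"
    have "prob {x \<in> space M. c / 2 * ?S x < - \<epsilon>} \<le> prob {x \<in> space M. b * ?S x < - \<epsilon>}"
    proof (rule finite_measure_mono)
      show "{x \<in> space M. c / 2 * ?S x < - \<epsilon>} \<subseteq> {x \<in> space M. b * ?S x < - \<epsilon>}"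
      proof safe
        fix x assume x: "c / 2 * ?S x < - \<epsilon>"
        have "?S x \<le> 0"
        proof (rule ccontr)
          assume "\<not> ?S x \<le> 0"
          then have "0 \<le> c / 2 * ?S x" using c by (intro mult_nonneg_nonneg) auto
          then show False using x \<epsilon> by linarith
        qed
        then have "b * ?S x \<le> c / 2 * ?S x" using c by (intro mult_right_mono_neg) auto
        then show "b * ?S x < - \<epsilon>" using x by linarith
      qed
    qed measurable
    then have "t / 2 * prob {x \<in> space M. c / 2 * ?S x < - \<epsilon>} \<le> t / 2 * prob {x \<in> space M. b * ?S x < - \<epsilon>}"
      using t by (intro mult_left_mono) auto
    moreover have "real n * laplace_excess (c / 2) \<le> exp \<epsilon> - 1 + t / 2 * prob {x \<in> space M. c / 2 * ?S x < - \<epsilon>} + exp 1 / (2 * t)"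
      using c qc \<epsilon> t by (intro laplace_excess_le_lower_tail) auto
    ultimately show ?thesis using \<eta> by linarith
  qed
  have halfd: "real n * laplace_excess c \<le> 10 * \<eta>" if c: "0 \<le> c" "c \<le> b" and qc: "real n * laplace_excess c \<le> 1" for c
  proof -
    have "real n * laplace_excess c \<le> real n * (10 * laplace_excess (c / 2))"
      using laplace_excess_double[of "c / 2"] c b by (intro mult_left_mono) auto
    then show ?thesis using half[OF c qc] by simp
  qed
  \<comment> \<open>At scale \<open>b / 2 ^ j\<close> the excess shrinks by the factor
    \<open>2 ^ j\<close> through convexity, which starts the induction.\<close>
  obtain j where j: "real n * laplace_excess b < 2 ^ j"
    using real_arch_pow[of 2 "real n * laplace_excess b"] by auto
  \<comment> \<open>Only the crude bound 1 is carried upwards; \<open>halfd\<close> sharpens it once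
    the scale \<open>b\<close> is reached.\<close>
  have "real n * laplace_excess (b * 2 ^ i / 2 ^ j) \<le> 1" if "i \<le> j" for i
    using that
  proof (induction i)
    case 0
    have "real n * laplace_excess (1 / 2 ^ j * b) \<le> real n * (1 / 2 ^ j * laplace_excess b)"
      using b by (intro mult_left_mono laplace_excess_scale) auto
    also have "\<dots> \<le> 1" using j by (simp add: divide_le_eq)
    finally show ?case by simp
  next
    case (Suc i)
    define c where "c = b * 2 ^ i / 2 ^ j"
    have "(2::real) ^ i \<le> 2 ^ j" using Suc.prems by (intro power_increasing) auto
    then have "b * 2 ^ i \<le> b * 2 ^ j" using b by (intro mult_left_mono) auto
    then have c: "0 \<le> c" "c \<le> b" using b by (auto simp: c_def divide_le_eq)
    have "real n * laplace_excess c \<le> 10 * \<eta>"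
      using Suc c by (intro halfd) (auto simp: c_def)
    moreover have "real n * laplace_excess (2 * c) \<le> real n * (10 * laplace_excess c)"
      using c b by (intro mult_left_mono laplace_excess_double) auto
    \<comment> \<open>\<open>halfd\<close> gives \<open>10 * \<eta>\<close> at \<open>c\<close>, and
      doubling costs another factor 10; this is where \<open>100 * \<eta> \<le> 1\<close>
      enters.\<close>
    ultimately have "real n * laplace_excess (2 * c) \<le> 1" using small by simp
    then show ?case by (simp add: c_def mult_ac)
  qed
  from this[of j] show ?thesis using b by (intro halfd) auto
qed

lemma laplace_excess_tendsto_0:
  fixes d :: "nat \<Rightarrow> nat"
  assumes d: "\<And>n. n \<ge> 1 \<Longrightarrow> d n \<in> {1..n}"
    and lower: "\<And>\<epsilon>. 0 < \<epsilon> \<Longrightarrow>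
      (\<lambda>n. prob {x \<in> space M. real (d n) / real n * (\<Sum>k=1..n. Z k x - 1) < - \<epsilon>}) \<longlonglongrightarrow> 0"
  shows "(\<lambda>n. real n * laplace_excess (real (d n) / real n)) \<longlonglongrightarrow> 0"
proof (rule tendsto_sandwich[where f = "\<lambda>_. 0" and h = "\<lambda>n. \<bar>real n * laplace_excess (real (d n) / real n)\<bar>"])
  show "(\<lambda>n. \<bar>real n * laplace_excess (real (d n) / real n)\<bar>) \<longlonglongrightarrow> 0"
  proof (rule LIMSEQ_I)
    fix r :: real assume r: "0 < r"
    \<comment> \<open>The cap \<open>1 / 100\<close> is what the bootstrap requires, and
      \<open>r / 20\<close> makes its conclusion smaller than \<open>r\<close>. Below,
      \<open>\<epsilon>\<close> and \<open>t\<close> give two of the three terms of the bound the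
      value \<open>\<eta> / 3\<close>; the probability term falls below that for large
      \<open>n\<close>.\<close>
    define \<eta> where "\<eta> = min (r / 20) (1 / 100)"
    have \<eta>: "0 < \<eta>" "100 * \<eta> \<le> 1" "10 * \<eta> < r" using r by (auto simp: \<eta>_def)
    define \<epsilon> where "\<epsilon> = ln (1 + \<eta> / 3)"
    define t where "t = 3 * exp 1 / (2 * \<eta>)"
    have \<epsilon>: "0 < \<epsilon>" "exp \<epsilon> - 1 = \<eta> / 3" using \<eta> by (auto simp: \<epsilon>_def ln_gt_zero)
    have t: "0 < t" "exp 1 / (2 * t) = \<eta> / 3" using \<eta> by (auto simp: t_def)
    let ?P = "\<lambda>n. prob {x \<in> space M. real (d n) / real n * (\<Sum>k=1..n. Z k x - 1) < - \<epsilon>}"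
    have "eventually (\<lambda>n. ?P n < 2 * \<eta> / (3 * t)) sequentially"
      using order_tendstoD(2)[OF lower[OF \<epsilon>(1)], of "2 * \<eta> / (3 * t)"] \<eta> t by simp
    then have "eventually (\<lambda>n. norm (\<bar>real n * laplace_excess (real (d n) / real n)\<bar> - 0) < r) sequentially"
      using eventually_ge_at_top[of "1::nat"]
    proof eventually_elim
      case (elim n)
      have P: "t / 2 * ?P n \<le> \<eta> / 3" using elim(1) t by (simp add: field_simps)
      have "real n * laplace_excess (real (d n) / real n) \<le> 10 * \<eta>"
      proof (rule laplace_excess_le_lower_tail_bootstrap)
        show "exp \<epsilon> - 1 + t / 2 * ?P n + exp 1 / (2 * t) \<le> \<eta>"
          using P \<epsilon> t by linarith
        show "real (d n) / real n \<le> 1" using d[OF elim(2)] by (auto simp: divide_le_eq)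
      qed (use \<eta> \<epsilon> t in auto)
      then show ?case using \<eta> laplace_excess_nonneg by simp
    qed
    then show "\<exists>N. \<forall>n\<ge>N. norm (\<bar>real n * laplace_excess (real (d n) / real n)\<bar> - 0) < r"
      by (simp add: eventually_sequentially)
  qed
qed (auto simp: laplace_excess_nonneg)

section \<open>From exponential moments to truncated moments\<close>

text \<open>With \<open>b = d / n\<close>, the condition \<open>b * z > 1\<close> reads
  \<open>d * z > n\<close>; this and \<open>trunc_sq_mean\<close> are the two expectations in
  (iii).\<close>

definition tail_mean :: "real \<Rightarrow> real" where
  "tail_mean b = expectation (\<lambda>x. Z 0 x * indicator {z. b * z > 1} (Z 0 x))"

definition trunc_sq_mean :: "real \<Rightarrow> real" where
  "trunc_sq_mean b = expectation (\<lambda>x. (Z 0 x)\<^sup>2 * indicator {z. b * z \<le> 1} (Z 0 x))"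

lemma integrable_tail: "integrable M (\<lambda>x. Z 0 x * indicator {z. b * z > 1} (Z 0 x))"
  by (rule Bochner_Integration.integrable_bound[OF Z_integrable]) (auto simp: indicator_def)

lemma integrable_trunc_sq:
  assumes "0 < b"
  shows "integrable M (\<lambda>x. (Z 0 x)\<^sup>2 * indicator {z. b * z \<le> 1} (Z 0 x))"
proof (rule integrable_const_bound[where B = "(1 / b)\<^sup>2"])
  show "AE x in M. norm ((Z 0 x)\<^sup>2 * indicator {z. b * z \<le> 1} (Z 0 x)) \<le> (1 / b)\<^sup>2"
    using Z_nonneg[of 0]
  proof eventually_elim
    case (elim x)
    have "(Z 0 x)\<^sup>2 \<le> (1 / b)\<^sup>2" if "b * Z 0 x \<le> 1"
      using that elim assms by (intro power_mono) (auto simp: field_simps)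
    then show ?case by (auto simp: indicator_def)
  qed
qed measurable

lemma tail_mean_nonneg: "0 \<le> tail_mean b"
  unfolding tail_mean_def by (intro integral_nonneg_AE) (use Z_nonneg[of 0] in \<open>auto simp: indicator_def\<close>)

lemma trunc_sq_mean_nonneg: "0 \<le> trunc_sq_mean b"
  unfolding trunc_sq_mean_def by (intro integral_nonneg_AE) auto

text \<open>A constant that bounds \<open>b\<^sup>2\<close> by a multiple of
  \<open>laplace_excess b\<close>. Restricting to \<open>Z \<le> 1\<close> keeps it finite and makes
  the argument of \<open>exp_rem\<close> nonpositive, where the quadratic lower bound holds
  throughout.\<close>

definition lower_var :: real where
  "lower_var = expectation (\<lambda>x. (Z 0 x - 1)\<^sup>2 * indicator {z. z \<le> 1} (Z 0 x))"

lemma integrable_lower_var: "integrable M (\<lambda>x. (Z 0 x - 1)\<^sup>2 * indicator {z. z \<le> 1} (Z 0 x))"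
proof (rule integrable_const_bound[where B = 1])
  show "AE x in M. norm ((Z 0 x - 1)\<^sup>2 * indicator {z. z \<le> 1} (Z 0 x)) \<le> 1"
    using Z_nonneg[of 0]
  proof eventually_elim
    case (elim x)
    have "(1 - Z 0 x)\<^sup>2 \<le> 1\<^sup>2" if "Z 0 x \<le> 1"
      using that elim by (intro power_mono) auto
    then show ?case by (auto simp: indicator_def power2_commute)
  qed
qed measurable

text \<open>Were it 0, then \<open>Z \<ge> 1\<close> almost surely, and the mean 1 would force
  \<open>Z = 1\<close> almost surely, against nondegeneracy.\<close>

lemma lower_var_pos: "0 < lower_var"
proof -
  have "0 \<le> lower_var"
    unfolding lower_var_def by (intro integral_nonneg_AE) auto
  moreover have "lower_var \<noteq> 0"
  proof
    assume "lower_var = 0"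
    then have "AE x in M. (Z 0 x - 1)\<^sup>2 * indicator {z. z \<le> 1} (Z 0 x) = 0"
      unfolding lower_var_def using integrable_lower_var
      by (subst (asm) integral_nonneg_eq_0_iff_AE) auto
    then have ge: "AE x in M. 0 \<le> Z 0 x - 1"
      by eventually_elim (auto simp: indicator_def split: if_splits)
    have "expectation (\<lambda>x. Z 0 x - 1) = 0"
      using Z_integrable Z_mean by (simp add: prob_space)
    then have "AE x in M. Z 0 x - 1 = 0"
      using integral_nonneg_eq_0_iff_AE[OF _ ge] Z_integrable by simp
    then have "AE x in M. Z 0 x = 1" by eventually_elim simp
    then show False using Z_nondegenerate by (auto simp: nondegenerate_def)
  qed
  ultimately show ?thesis by simp
qed

lemma lower_var_le_laplace_excess:
  assumes "0 \<le> b"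
  shows "b\<^sup>2 * lower_var \<le> 2 * laplace_excess b"
proof -
  have "expectation (\<lambda>x. b\<^sup>2 * ((Z 0 x - 1)\<^sup>2 * indicator {z. z \<le> 1} (Z 0 x)))
      \<le> expectation (\<lambda>x. 2 * exp_rem (b * (Z 0 x - 1)))"
  proof (rule integral_mono)
    fix x
    have "b\<^sup>2 * (Z 0 x - 1)\<^sup>2 \<le> 2 * exp_rem (b * (Z 0 x - 1))" if "Z 0 x \<le> 1"
      using exp_rem_ge_nonpos[of "b * (Z 0 x - 1)"] that assms
      by (simp add: power_mult_distrib mult_nonneg_nonpos)
    then show "b\<^sup>2 * ((Z 0 x - 1)\<^sup>2 * indicator {z. z \<le> 1} (Z 0 x)) \<le> 2 * exp_rem (b * (Z 0 x - 1))"
      by (auto simp: indicator_def exp_rem_nonneg)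
  qed (use integrable_lower_var integrable_exp_rem_Z[OF assms] in auto)
  then show ?thesis by (simp add: lower_var_def laplace_excess_def)
qed

text \<open>Put \<open>y = b * (Z - 1)\<close>. If \<open>b * Z > 1\<close> and
  \<open>b \<le> 1 / 2\<close>, then \<open>y \<ge> 1 / 2 \<ge> b\<close>, so
  \<open>b * Z = y + b \<le> 2 * y\<close>, and the linear bound on \<open>exp_rem\<close>
  applies.\<close>

lemma tail_mean_le_laplace_excess:
  assumes "0 \<le> b" "b \<le> 1 / 2"
  shows "b * tail_mean b \<le> 32 * laplace_excess b"
proof -
  have "expectation (\<lambda>x. b * (Z 0 x * indicator {z. b * z > 1} (Z 0 x)))
      \<le> expectation (\<lambda>x. 32 * exp_rem (b * (Z 0 x - 1)))"
  proof (rule integral_mono)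
    fix x
    have "b * Z 0 x \<le> 32 * exp_rem (b * (Z 0 x - 1))" if "b * Z 0 x > 1"
    proof -
      have "1 / 2 \<le> b * (Z 0 x - 1)" "b * Z 0 x \<le> 2 * (b * (Z 0 x - 1))"
        using that assms by (auto simp: right_diff_distrib)
      with exp_rem_ge_large[of "b * (Z 0 x - 1)"] show ?thesis by linarith
    qed
    then show "b * (Z 0 x * indicator {z. b * z > 1} (Z 0 x)) \<le> 32 * exp_rem (b * (Z 0 x - 1))"
      by (auto simp: indicator_def exp_rem_nonneg)
  qed (use integrable_tail integrable_exp_rem_Z[OF assms(1)] in auto)
  then show ?thesis by (simp add: tail_mean_def laplace_excess_def)
qed

text \<open>From \<open>b * Z = y + b\<close> follows
  \<open>(b * Z)\<^sup>2 \<le> 2 * y\<^sup>2 + 2 * b\<^sup>2\<close>, and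
  \<open>y\<^sup>2 \<le> 8 * exp_rem y\<close> because \<open>y \<le> 1\<close> on the truncation
  event.\<close>

lemma trunc_sq_mean_le_laplace_excess:
  assumes "0 < b"
  shows "b\<^sup>2 * trunc_sq_mean b \<le> 2 * b\<^sup>2 + 16 * laplace_excess b"
proof -
  have "expectation (\<lambda>x. b\<^sup>2 * ((Z 0 x)\<^sup>2 * indicator {z. b * z \<le> 1} (Z 0 x)))
      \<le> expectation (\<lambda>x. 2 * b\<^sup>2 + 16 * exp_rem (b * (Z 0 x - 1)))"
  proof (rule integral_mono)
    fix x
    have "b\<^sup>2 * (Z 0 x)\<^sup>2 \<le> 2 * b\<^sup>2 + 16 * exp_rem (b * (Z 0 x - 1))" if "b * Z 0 x \<le> 1"
    proof -
      let ?y = "b * (Z 0 x - 1)"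
      have "?y \<le> 1" using that assms by (simp add: right_diff_distrib)
      then have y: "?y\<^sup>2 \<le> 8 * exp_rem ?y"
        using exp_rem_ge_unit[of ?y] exp_rem_ge_nonpos[of ?y] exp_rem_nonneg[of ?y] by linarith
      have "0 \<le> (?y - b)\<^sup>2" by simp
      also have "\<dots> = 2 * ?y\<^sup>2 + 2 * b\<^sup>2 - b\<^sup>2 * (Z 0 x)\<^sup>2"
        by (simp add: power2_eq_square algebra_simps)
      finally show ?thesis using y by linarith
    qed
    then show "b\<^sup>2 * ((Z 0 x)\<^sup>2 * indicator {z. b * z \<le> 1} (Z 0 x)) \<le> 2 * b\<^sup>2 + 16 * exp_rem (b * (Z 0 x - 1))"
      by (auto simp: indicator_def exp_rem_nonneg)
  qed (use integrable_trunc_sq[OF assms] integrable_exp_rem_Z[of b] assms in auto)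
  then show ?thesis
    using integrable_exp_rem_Z[of b] assms by (simp add: trunc_sq_mean_def laplace_excess_def prob_space)
qed

lemma moment_conditions_of_lower_tail:
  fixes d :: "nat \<Rightarrow> nat"
  assumes d: "\<And>n. n \<ge> 1 \<Longrightarrow> d n \<in> {1..n}"
    and lower: "\<And>\<epsilon>. 0 < \<epsilon> \<Longrightarrow>
      (\<lambda>n. prob {x \<in> space M. real (d n) / real n * (\<Sum>k=1..n. Z k x - 1) < - \<epsilon>}) \<longlonglongrightarrow> 0"
  shows "(\<lambda>n. real (d n) * tail_mean (real (d n) / real n)) \<longlonglongrightarrow> 0"
    and "(\<lambda>n. (real (d n))\<^sup>2 * trunc_sq_mean (real (d n) / real n) / real n) \<longlonglongrightarrow> 0"
proof -
  define b where "b n = real (d n) / real n" for n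
  have q: "(\<lambda>n. real n * laplace_excess (b n)) \<longlonglongrightarrow> 0"
    unfolding b_def using d lower by (rule laplace_excess_tendsto_0)
  have b: "0 < b n" "b n \<le> 1" "real n * b n = real (d n)" if "n \<ge> 1" for n
    using d[OF that] that by (auto simp: b_def divide_le_eq)
  have b0: "0 \<le> b n" for n by (simp add: b_def)
  \<comment> \<open>This says \<open>d\<^sup>2 = o(n)\<close>. It forces \<open>b n\<close> below
    \<open>1 / 2\<close> eventually, as the tail bound needs, and it absorbs the term
    \<open>2 * b\<^sup>2\<close> in the bound for \<open>trunc_sq_mean\<close>.\<close>
  have nb: "(\<lambda>n. real n * (b n)\<^sup>2) \<longlonglongrightarrow> 0"
  proof (rule tendsto_sandwich[where f = "\<lambda>_. 0" and h = "\<lambda>n. 2 / lower_var * (real n * laplace_excess (b n))"])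
    show "\<forall>\<^sub>F n in sequentially. real n * (b n)\<^sup>2 \<le> 2 / lower_var * (real n * laplace_excess (b n))"
    proof (rule always_eventually, rule allI)
      fix n
      have "real n * ((b n)\<^sup>2 * lower_var) \<le> real n * (2 * laplace_excess (b n))"
        using lower_var_le_laplace_excess[OF b0] by (intro mult_left_mono) auto
      then show "real n * (b n)\<^sup>2 \<le> 2 / lower_var * (real n * laplace_excess (b n))"
        using lower_var_pos by (simp add: field_simps)
    qed
    show "(\<lambda>n. 2 / lower_var * (real n * laplace_excess (b n))) \<longlonglongrightarrow> 0"
      using tendsto_mult_left[OF q, of "2 / lower_var"] by simp
  qed auto
  have "eventually (\<lambda>n. real n * (b n)\<^sup>2 < 1 / 4) sequentially"
    by (rule order_tendstoD(2)[OF nb]) simp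
  then have half: "eventually (\<lambda>n. b n \<le> 1 / 2) sequentially"
    using eventually_ge_at_top[of "1::nat"]
  proof eventually_elim
    case (elim n)
    have "1 * (b n)\<^sup>2 \<le> real n * (b n)\<^sup>2" using elim(2) by (intro mult_right_mono) auto
    then have "(b n)\<^sup>2 \<le> (1 / 2)\<^sup>2" using elim(1) by (simp add: power2_eq_square)
    then show ?case by (rule power2_le_imp_le) simp
  qed
  show "(\<lambda>n. real (d n) * tail_mean (real (d n) / real n)) \<longlonglongrightarrow> 0"
  proof (rule tendsto_sandwich[where f = "\<lambda>_. 0" and h = "\<lambda>n. 32 * (real n * laplace_excess (b n))"])
    show "\<forall>\<^sub>F n in sequentially. real (d n) * tail_mean (real (d n) / real n) \<le> 32 * (real n * laplace_excess (b n))"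
      using half eventually_ge_at_top[of "1::nat"]
    proof eventually_elim
      case (elim n)
      have "real n * (b n * tail_mean (b n)) \<le> real n * (32 * laplace_excess (b n))"
        using tail_mean_le_laplace_excess[OF b0 elim(1)] by (intro mult_left_mono) auto
      then show ?case unfolding b_def[symmetric] b(3)[OF elim(2), symmetric] by (simp add: mult_ac)
    qed
    show "(\<lambda>n. 32 * (real n * laplace_excess (b n))) \<longlonglongrightarrow> 0"
      using tendsto_mult_left[OF q, of 32] by simp
  qed (auto simp: tail_mean_nonneg)
  show "(\<lambda>n. (real (d n))\<^sup>2 * trunc_sq_mean (real (d n) / real n) / real n) \<longlonglongrightarrow> 0"
  proof (rule tendsto_sandwich[where f = "\<lambda>_. 0" and h = "\<lambda>n. 2 * (real n * (b n)\<^sup>2) + 16 * (real n * laplace_excess (b n))"])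
    show "\<forall>\<^sub>F n in sequentially. (real (d n))\<^sup>2 * trunc_sq_mean (real (d n) / real n) / real n
        \<le> 2 * (real n * (b n)\<^sup>2) + 16 * (real n * laplace_excess (b n))"
    proof (rule eventually_sequentiallyI[of 1])
      fix n :: nat assume n: "1 \<le> n"
      have "real n * ((b n)\<^sup>2 * trunc_sq_mean (b n)) \<le> real n * (2 * (b n)\<^sup>2 + 16 * laplace_excess (b n))"
        using trunc_sq_mean_le_laplace_excess[OF b(1)[OF n]] by (intro mult_left_mono) auto
      moreover have "(real (d n))\<^sup>2 / real n = real n * (b n)\<^sup>2"
        using n by (simp add: b_def power_divide power2_eq_square)
      then have "(real (d n))\<^sup>2 * trunc_sq_mean (b n) / real n = real n * ((b n)\<^sup>2 * trunc_sq_mean (b n))"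
        by (metis mult.assoc times_divide_eq_left)
      ultimately show "(real (d n))\<^sup>2 * trunc_sq_mean (real (d n) / real n) / real n
        \<le> 2 * (real n * (b n)\<^sup>2) + 16 * (real n * laplace_excess (b n))"
        unfolding b_def[symmetric] by (simp add: algebra_simps)
    qed
    show "(\<lambda>n. 2 * (real n * (b n)\<^sup>2) + 16 * (real n * laplace_excess (b n))) \<longlonglongrightarrow> 0"
      using tendsto_add[OF tendsto_mult_left[OF nb, of 2] tendsto_mult_left[OF q, of 16]] by simp
  qed (auto simp: trunc_sq_mean_nonneg)
qed

end

section \<open>Truncation\<close>

context iid_unit_mean
begin

text \<open>Large values are replaced by 0 and not by the threshold, so that the first two moments
  are exactly \<open>1 - tail_mean b\<close> and \<open>trunc_sq_mean b\<close>.\<close>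

definition trunc :: "real \<Rightarrow> real \<Rightarrow> real" where
  "trunc b z = z * indicator {z. b * z \<le> 1} z"

lemma trunc_measurable [measurable]: "trunc b \<in> borel_measurable borel"
  unfolding trunc_def[abs_def] by measurable

lemma integrable_trunc: "integrable M (\<lambda>x. trunc b (Z 0 x))"
  unfolding trunc_def
  by (rule Bochner_Integration.integrable_bound[OF Z_integrable]) (auto simp: indicator_def)

lemma trunc_sq: "(trunc b z)\<^sup>2 = z\<^sup>2 * indicator {z. b * z \<le> 1} z"
  by (simp add: trunc_def indicator_def)

lemma expectation_trunc: "expectation (\<lambda>x. trunc b (Z 0 x)) = 1 - tail_mean b"
proof -
  have e: "trunc b z = z - z * indicator {z. b * z > 1} z" for z
    by (auto simp: trunc_def indicator_def)
  show ?thesis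
    unfolding e tail_mean_def using Z_integrable integrable_tail by (simp add: Z_mean)
qed

lemma expectation_trunc_sq: "expectation (\<lambda>x. (trunc b (Z 0 x))\<^sup>2) = trunc_sq_mean b"
  unfolding trunc_sq trunc_sq_mean_def ..

lemma integrable_trunc_power2:
  assumes "0 < b"
  shows "integrable M (\<lambda>x. (trunc b (Z 0 x))\<^sup>2)"
  unfolding trunc_sq by (rule integrable_trunc_sq[OF assms])

lemma tail_mean_le_1: "tail_mean b \<le> 1"
proof -
  have "0 \<le> expectation (\<lambda>x. trunc b (Z 0 x))"
    by (intro integral_nonneg_AE) (use Z_nonneg[of 0] in \<open>auto simp: trunc_def indicator_def\<close>)
  then show ?thesis by (simp add: expectation_trunc)
qed

lemma AE_Z_all_nonneg: "AE x in M. \<forall>k. 0 \<le> Z k x"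
  using Z_nonneg by (simp add: AE_all_countable)

lemma one_minus_power_tail_mean: "1 - real d * tail_mean b \<le> (1 - tail_mean b) ^ d"
  using Bernoulli_inequality[of "- tail_mean b" d] tail_mean_le_1[of b] by simp

text \<open>Truncation only lowers nonnegative summands, so the absolute value is redundant almost
  surely and the mean error is computed by linearity.\<close>

lemma
  shows integrable_sum_trunc_diff: "integrable M (\<lambda>x. \<bar>b * (\<Sum>k=1..n. Z k x - 1) - b * (\<Sum>k=1..n. trunc b (Z k x) - 1)\<bar>)"
    and expectation_sum_trunc_diff: "0 \<le> b \<Longrightarrow>
      expectation (\<lambda>x. \<bar>b * (\<Sum>k=1..n. Z k x - 1) - b * (\<Sum>k=1..n. trunc b (Z k x) - 1)\<bar>)
        = b * (real n * tail_mean b)"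
proof -
  let ?D = "\<lambda>x. b * (\<Sum>k=1..n. Z k x - trunc b (Z k x))"
  have e: "b * (\<Sum>k=1..n. Z k x - 1) - b * (\<Sum>k=1..n. trunc b (Z k x) - 1) = ?D x" for x
    by (simp add: sum_subtractf algebra_simps)
  have int: "integrable M (\<lambda>x. Z k x - trunc b (Z k x))" for k
    using Z_integrable integrable_trunc[of b] by (subst integrable_Z_iff[of "\<lambda>z. z - trunc b z"]) auto
  have Ex: "expectation (\<lambda>x. Z k x - trunc b (Z k x)) = tail_mean b" for k
    using Z_integrable integrable_trunc[of b]
    by (subst expectation_Z[of "\<lambda>z. z - trunc b z"]) (auto simp: expectation_trunc Z_mean)
  show "integrable M (\<lambda>x. \<bar>b * (\<Sum>k=1..n. Z k x - 1) - b * (\<Sum>k=1..n. trunc b (Z k x) - 1)\<bar>)"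
    unfolding e using int by (intro integrable_abs integrable_mult_right Bochner_Integration.integrable_sum)
  assume b: "0 \<le> b"
  have "expectation (\<lambda>x. \<bar>?D x\<bar>) = expectation ?D"
  proof (rule integral_cong_AE)
    show "AE x in M. \<bar>?D x\<bar> = ?D x"
      using AE_Z_all_nonneg
    proof eventually_elim
      case (elim x)
      have "0 \<le> (\<Sum>k=1..n. Z k x - trunc b (Z k x))"
        using elim by (intro sum_nonneg) (auto simp: trunc_def indicator_def)
      then show ?case using b by (simp add: abs_of_nonneg)
    qed
  qed measurable
  also have "\<dots> = b * (real n * tail_mean b)"
    using int by (simp add: Ex del: sum_subtractf)
  finally show "expectation (\<lambda>x. \<bar>b * (\<Sum>k=1..n. Z k x - 1) - b * (\<Sum>k=1..n. trunc b (Z k x) - 1)\<bar>)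
        = b * (real n * tail_mean b)"
    unfolding e .
qed

text \<open>The square is expanded into pairs. Centring is at 1 while the truncated mean is
  \<open>1 - tail_mean b\<close>, so each off-diagonal pair contributes
  \<open>(tail_mean b)\<^sup>2\<close>; a diagonal pair adds at most \<open>trunc_sq_mean b\<close>
  to that.\<close>

lemma
  assumes b: "0 < b"
  shows integrable_sum_trunc_sq: "integrable M (\<lambda>x. (b * (\<Sum>k=1..n. trunc b (Z k x) - 1))\<^sup>2)"
    and expectation_sum_trunc_sq_le: "expectation (\<lambda>x. (b * (\<Sum>k=1..n. trunc b (Z k x) - 1))\<^sup>2)
      \<le> b\<^sup>2 * (real n * trunc_sq_mean b + (real n * tail_mean b)\<^sup>2)"
proof -
  define u where "u z = trunc b z - 1" for z
  have [measurable]: "u \<in> borel_measurable borel" unfolding u_def[abs_def] by measurable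
  have intu: "integrable M (\<lambda>x. u (Z 0 x))" unfolding u_def using integrable_trunc by simp
  have Eu: "expectation (\<lambda>x. u (Z 0 x)) = - tail_mean b"
    unfolding u_def using integrable_trunc by (simp add: expectation_trunc prob_space)
  have u2: "(u z)\<^sup>2 = (trunc b z)\<^sup>2 - 2 * trunc b z + 1" for z
    by (simp add: u_def power2_eq_square algebra_simps)
  have intu2: "integrable M (\<lambda>x. (u (Z 0 x))\<^sup>2)"
    unfolding u2 using integrable_trunc integrable_trunc_power2[OF b] by simp
  have "expectation (\<lambda>x. (u (Z 0 x))\<^sup>2) = trunc_sq_mean b - 2 * (1 - tail_mean b) + 1"
    unfolding u2 using integrable_trunc integrable_trunc_power2[OF b]
    by (simp add: expectation_trunc expectation_trunc_sq prob_space)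
  also have "\<dots> = trunc_sq_mean b - (1 - tail_mean b)\<^sup>2 + (tail_mean b)\<^sup>2"
    by (simp add: power2_eq_square algebra_simps)
  also have "\<dots> \<le> trunc_sq_mean b + (tail_mean b)\<^sup>2" by simp
  finally have Eu2: "expectation (\<lambda>x. (u (Z 0 x))\<^sup>2) \<le> trunc_sq_mean b + (tail_mean b)\<^sup>2" .
  have pair: "integrable M (\<lambda>x. u (Z j x) * u (Z k x))"
    "expectation (\<lambda>x. u (Z j x) * u (Z k x)) \<le> (if j = k then trunc_sq_mean b else 0) + (tail_mean b)\<^sup>2" for j k
  proof -
    have "integrable M (\<lambda>x. u (Z j x) * u (Z k x)) \<and>
      expectation (\<lambda>x. u (Z j x) * u (Z k x)) \<le> (if j = k then trunc_sq_mean b else 0) + (tail_mean b)\<^sup>2"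
    proof (cases "j = k")
      case True
      have "integrable M (\<lambda>x. (u (Z k x))\<^sup>2)"
        using intu2 by (subst integrable_Z_iff[of "\<lambda>z. (u z)\<^sup>2"]) auto
      moreover have "expectation (\<lambda>x. (u (Z k x))\<^sup>2) = expectation (\<lambda>x. (u (Z 0 x))\<^sup>2)"
        by (rule expectation_Z[of "\<lambda>z. (u z)\<^sup>2"]) auto
      ultimately show ?thesis using True Eu2 by (simp add: power2_eq_square)
    next
      case False
      have e: "(\<Prod>i\<in>{j, k}. u (Z i x)) = u (Z j x) * u (Z k x)" for x using False by simp
      have "integrable M (\<lambda>x. \<Prod>i\<in>{j, k}. u (Z i x))"
        by (rule integrable_prod_Z) (use intu in auto)
      moreover have "expectation (\<lambda>x. \<Prod>i\<in>{j, k}. u (Z i x)) = (\<Prod>i\<in>{j, k}. expectation (\<lambda>x. u (Z 0 x)))"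
        by (rule expectation_prod_Z) (use intu in auto)
      ultimately show ?thesis using False unfolding e by (simp add: Eu power2_eq_square)
    qed
    then show "integrable M (\<lambda>x. u (Z j x) * u (Z k x))"
      "expectation (\<lambda>x. u (Z j x) * u (Z k x)) \<le> (if j = k then trunc_sq_mean b else 0) + (tail_mean b)\<^sup>2"
      by auto
  qed
  have e: "(b * (\<Sum>k=1..n. trunc b (Z k x) - 1))\<^sup>2 = b\<^sup>2 * (\<Sum>j=1..n. \<Sum>k=1..n. u (Z j x) * u (Z k x))" for x
    by (simp add: u_def power_mult_distrib power2_eq_square sum_product)
  show "integrable M (\<lambda>x. (b * (\<Sum>k=1..n. trunc b (Z k x) - 1))\<^sup>2)"
    unfolding e using pair(1) by simp
  have "expectation (\<lambda>x. (b * (\<Sum>k=1..n. trunc b (Z k x) - 1))\<^sup>2)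
      = b\<^sup>2 * (\<Sum>j=1..n. \<Sum>k=1..n. expectation (\<lambda>x. u (Z j x) * u (Z k x)))"
    unfolding e using pair(1) by simp
  also have "\<dots> \<le> b\<^sup>2 * (\<Sum>j=1..n. \<Sum>k=1..n. (if j = k then trunc_sq_mean b else 0) + (tail_mean b)\<^sup>2)"
    using pair(2) by (intro mult_left_mono sum_mono) auto
  also have "(\<Sum>j=1..n. \<Sum>k=1..n. (if j = k then trunc_sq_mean b else 0) + (tail_mean b)\<^sup>2)
      = real n * trunc_sq_mean b + (real n * tail_mean b)\<^sup>2"
    by (simp add: sum.distrib sum.delta power2_eq_square algebra_simps)
  finally show "expectation (\<lambda>x. (b * (\<Sum>k=1..n. trunc b (Z k x) - 1))\<^sup>2)
      \<le> b\<^sup>2 * (real n * trunc_sq_mean b + (real n * tail_mean b)\<^sup>2)" .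
qed

section \<open>Moments of the symmetric sums\<close>

lemma
  assumes [measurable]: "f \<in> borel_measurable borel" and int: "integrable M (\<lambda>x. f (Z 0 x))"
  shows integrable_elem_sym: "integrable M (\<lambda>x. elem_sym {1..n} (\<lambda>i. f (Z i x)) d)"
    and expectation_elem_sym: "expectation (\<lambda>x. elem_sym {1..n} (\<lambda>i. f (Z i x)) d)
      = real (n choose d) * expectation (\<lambda>x. f (Z 0 x)) ^ d"
proof -
  have 1: "integrable M (\<lambda>x. \<Prod>i\<in>I. f (Z i x))"
    "expectation (\<lambda>x. \<Prod>i\<in>I. f (Z i x)) = expectation (\<lambda>x. f (Z 0 x)) ^ d"
    if "I \<in> {I. I \<subseteq> {1..n} \<and> card I = d}" for I
  proof -
    have "finite I" using that finite_subset by auto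
    then show "integrable M (\<lambda>x. \<Prod>i\<in>I. f (Z i x))"
      by (rule integrable_prod_Z) (use int in auto)
    have "expectation (\<lambda>x. \<Prod>i\<in>I. f (Z i x)) = (\<Prod>i\<in>I. expectation (\<lambda>x. f (Z 0 x)))"
      using \<open>finite I\<close> by (rule expectation_prod_Z) (use int in auto)
    then show "expectation (\<lambda>x. \<Prod>i\<in>I. f (Z i x)) = expectation (\<lambda>x. f (Z 0 x)) ^ d"
      using that by simp
  qed
  show "integrable M (\<lambda>x. elem_sym {1..n} (\<lambda>i. f (Z i x)) d)"
    unfolding elem_sym_def by (intro Bochner_Integration.integrable_sum 1)
  have "expectation (\<lambda>x. elem_sym {1..n} (\<lambda>i. f (Z i x)) d)
      = (\<Sum>I | I \<subseteq> {1..n} \<and> card I = d. expectation (\<lambda>x. \<Prod>i\<in>I. f (Z i x)))"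
    unfolding elem_sym_def by (rule Bochner_Integration.integral_sum) (rule 1)
  also have "\<dots> = (\<Sum>I | I \<subseteq> {1..n} \<and> card I = d. expectation (\<lambda>x. f (Z 0 x)) ^ d)"
    by (rule sum.cong[OF refl]) (rule 1)
  also have "\<dots> = real (n choose d) * expectation (\<lambda>x. f (Z 0 x)) ^ d"
    by (simp add: n_subsets)
  finally show "expectation (\<lambda>x. elem_sym {1..n} (\<lambda>i. f (Z i x)) d)
      = real (n choose d) * expectation (\<lambda>x. f (Z 0 x)) ^ d" .
qed

text \<open>The products over \<open>I\<close> and \<open>J\<close> merge into one over
  \<open>I \<union> J\<close> with squares on \<open>I \<inter> J\<close>. First powers have mean in
  [0, 1] and squares have mean at most \<open>1 + trunc_sq_mean b\<close>, so a pair contributes at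
  most a power with exponent \<open>card (I \<inter> J)\<close>, which
  \<open>sum_power_card_Int_le\<close> sums.\<close>

lemma
  assumes b: "0 < b"
  shows integrable_elem_sym_trunc_sq: "integrable M (\<lambda>x. (elem_sym {1..n} (\<lambda>i. trunc b (Z i x)) d)\<^sup>2)"
    and expectation_elem_sym_trunc_sq_le: "expectation (\<lambda>x. (elem_sym {1..n} (\<lambda>i. trunc b (Z i x)) d)\<^sup>2)
      \<le> (real (n choose d))\<^sup>2 * (1 + trunc_sq_mean b * real d / real n) ^ d"
proof -
  let ?S = "{I. I \<subseteq> {1..n} \<and> card I = d}"
  let ?s = "trunc_sq_mean b"
  have pair: "integrable M (\<lambda>x. (\<Prod>i\<in>I. trunc b (Z i x)) * (\<Prod>i\<in>J. trunc b (Z i x))) \<and>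
    expectation (\<lambda>x. (\<Prod>i\<in>I. trunc b (Z i x)) * (\<Prod>i\<in>J. trunc b (Z i x))) \<le> (1 + ?s) ^ card (I \<inter> J)"
    if I: "I \<in> ?S" and J: "J \<in> ?S" for I J
  proof -
    have fin: "finite I" "finite J" using I J finite_subset by auto
    define g where "g i z = (if i \<in> I \<inter> J then (trunc b z)\<^sup>2 else trunc b z)" for i z
    have [measurable]: "g i \<in> borel_measurable borel" for i
      unfolding g_def[abs_def] by measurable
    have intg: "integrable M (\<lambda>x. g i (Z 0 x))" for i
      using integrable_trunc integrable_trunc_power2[OF b] by (cases "i \<in> I \<inter> J") (auto simp: g_def)
    have e: "(\<Prod>i\<in>I. y i) * (\<Prod>i\<in>J. y i) = (\<Prod>i\<in>I \<union> J. if i \<in> I \<inter> J then (y i)\<^sup>2 else y i)" for y :: "nat \<Rightarrow> real"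
    proof -
      have "(\<Prod>i\<in>I. y i) * (\<Prod>i\<in>J. y i) = (\<Prod>i\<in>I \<union> J. y i) * (\<Prod>i\<in>I \<inter> J. y i)"
        using prod.union_inter[OF fin, of y] by simp
      also have "(\<Prod>i\<in>I \<inter> J. y i) = (\<Prod>i\<in>I \<union> J. if i \<in> I \<inter> J then y i else 1)"
        using fin by (intro prod.mono_neutral_cong_left) auto
      also have "(\<Prod>i\<in>I \<union> J. y i) * \<dots> = (\<Prod>i\<in>I \<union> J. y i * (if i \<in> I \<inter> J then y i else 1))"
        by (rule prod.distrib[symmetric])
      also have "\<dots> = (\<Prod>i\<in>I \<union> J. if i \<in> I \<inter> J then (y i)\<^sup>2 else y i)"
        by (intro prod.cong) (auto simp: power2_eq_square)
      finally show ?thesis .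
    qed
    have e': "(\<Prod>i\<in>I. trunc b (Z i x)) * (\<Prod>i\<in>J. trunc b (Z i x)) = (\<Prod>i\<in>I \<union> J. g i (Z i x))" for x
      unfolding e g_def ..
    have "expectation (\<lambda>x. \<Prod>i\<in>I \<union> J. g i (Z i x)) = (\<Prod>i\<in>I \<union> J. expectation (\<lambda>x. g i (Z 0 x)))"
      by (rule expectation_prod_Z) (use fin intg in auto)
    also have "\<dots> \<le> (\<Prod>i\<in>I \<union> J. if i \<in> I \<inter> J then 1 + ?s else 1)"
    proof (rule prod_mono)
      fix i
      show "0 \<le> expectation (\<lambda>x. g i (Z 0 x)) \<and> expectation (\<lambda>x. g i (Z 0 x)) \<le> (if i \<in> I \<inter> J then 1 + ?s else 1)"
        using tail_mean_le_1[of b] tail_mean_nonneg[of b] trunc_sq_mean_nonneg[of b]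
        by (auto simp: g_def expectation_trunc expectation_trunc_sq)
    qed
    also have "\<dots> = (\<Prod>i\<in>I \<inter> J. 1 + ?s)"
      using fin by (intro prod.mono_neutral_cong_right) auto
    finally have "expectation (\<lambda>x. \<Prod>i\<in>I \<union> J. g i (Z i x)) \<le> (1 + ?s) ^ card (I \<inter> J)" by simp
    moreover have "integrable M (\<lambda>x. \<Prod>i\<in>I \<union> J. g i (Z i x))"
      by (rule integrable_prod_Z) (use fin intg in auto)
    ultimately show ?thesis unfolding e' by simp
  qed
  have sq: "(elem_sym {1..n} y d)\<^sup>2 = (\<Sum>I\<in>?S. \<Sum>J\<in>?S. (\<Prod>i\<in>I. y i) * (\<Prod>i\<in>J. y i))" for y :: "nat \<Rightarrow> real"
    by (simp add: elem_sym_def power2_eq_square sum_product)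
  show "integrable M (\<lambda>x. (elem_sym {1..n} (\<lambda>i. trunc b (Z i x)) d)\<^sup>2)"
    unfolding sq by (intro Bochner_Integration.integrable_sum pair[THEN conjunct1])
  have "expectation (\<lambda>x. (elem_sym {1..n} (\<lambda>i. trunc b (Z i x)) d)\<^sup>2)
      = (\<Sum>I\<in>?S. \<Sum>J\<in>?S. expectation (\<lambda>x. (\<Prod>i\<in>I. trunc b (Z i x)) * (\<Prod>i\<in>J. trunc b (Z i x))))"
    unfolding sq using pair[THEN conjunct1]
    by (subst Bochner_Integration.integral_sum)
       (auto intro!: sum.cong Bochner_Integration.integral_sum Bochner_Integration.integrable_sum)
  also have "\<dots> \<le> (\<Sum>I\<in>?S. \<Sum>J\<in>?S. (1 + ?s) ^ card (I \<inter> J))"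
    by (intro sum_mono pair[THEN conjunct2])
  also have "\<dots> \<le> (\<Sum>I\<in>?S. real (n choose d) * (1 + ?s * real d / real n) ^ d)"
  proof (rule sum_mono)
    fix I assume "I \<in> ?S"
    then show "(\<Sum>J\<in>?S. (1 + ?s) ^ card (I \<inter> J)) \<le> real (n choose d) * (1 + ?s * real d / real n) ^ d"
      using sum_power_card_Int_le[of "{1..n}" I d ?s] trunc_sq_mean_nonneg[of b] by simp
  qed
  also have "\<dots> = (real (n choose d))\<^sup>2 * (1 + ?s * real d / real n) ^ d"
    by (simp add: n_subsets power2_eq_square)
  finally show "expectation (\<lambda>x. (elem_sym {1..n} (\<lambda>i. trunc b (Z i x)) d)\<^sup>2)
      \<le> (real (n choose d))\<^sup>2 * (1 + ?s * real d / real n) ^ d" .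
qed

lemma elem_sym_measurable [measurable]:
  assumes [measurable]: "\<And>i. Y i \<in> borel_measurable M"
  shows "(\<lambda>x. elem_sym A (\<lambda>i. Y i x) d) \<in> borel_measurable M"
  unfolding elem_sym_def by measurable

lemma esym_sum_measurable [measurable]: "(\<lambda>x. esym_sum Z k n x) \<in> borel_measurable M"
  unfolding esym_sum_eq_elem_sym by measurable

section \<open>The implications along the sequence \<open>d\<close>\<close>

context
  fixes d :: "nat \<Rightarrow> nat"
  assumes d: "\<And>n. n \<ge> 1 \<Longrightarrow> d n \<in> {1..n}"
begin

definition ratio :: "nat \<Rightarrow> real" where
  "ratio n = real (d n) / real n"

lemma ratio_pos: "n \<ge> 1 \<Longrightarrow> 0 < ratio n"
  using d[of n] by (auto simp: ratio_def)

lemma ratio_nonneg: "0 \<le> ratio n"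
  by (simp add: ratio_def)

lemma choose_pos: "n \<ge> 1 \<Longrightarrow> 0 < real (n choose d n)"
  using d[of n] by simp

lemma scaled_sum_eq:
  assumes "n \<ge> 1"
  shows "real (d n) * ((\<Sum>k=1..n. Z k x) / real n - 1) = ratio n * (\<Sum>k=1..n. Z k x - 1)"
  using assms by (simp add: ratio_def sum_subtractf field_simps)

lemma moment_conditions_of_scaled_sum:
  assumes "tendsto_in_prob M (\<lambda>n x. real (d n) * ((\<Sum>k=1..n. Z k x) / real n - 1)) 0"
  shows "(\<lambda>n. real (d n) * tail_mean (ratio n)) \<longlonglongrightarrow> 0"
    and "(\<lambda>n. (real (d n))\<^sup>2 * trunc_sq_mean (ratio n) / real n) \<longlonglongrightarrow> 0"
proof -
  have lower: "(\<lambda>n. prob {x \<in> space M. real (d n) / real n * (\<Sum>k=1..n. Z k x - 1) < - \<epsilon>}) \<longlonglongrightarrow> 0"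
    if \<epsilon>: "0 < \<epsilon>" for \<epsilon>
  proof (rule tendsto_sandwich[where f = "\<lambda>_. 0"])
    show "(\<lambda>n. prob {x \<in> space M. \<bar>real (d n) * ((\<Sum>k=1..n. Z k x) / real n - 1) - 0\<bar> > \<epsilon>}) \<longlonglongrightarrow> 0"
      using assms \<epsilon> unfolding tendsto_in_prob_def by blast
    show "\<forall>\<^sub>F n in sequentially. prob {x \<in> space M. real (d n) / real n * (\<Sum>k=1..n. Z k x - 1) < - \<epsilon>}
      \<le> prob {x \<in> space M. \<bar>real (d n) * ((\<Sum>k=1..n. Z k x) / real n - 1) - 0\<bar> > \<epsilon>}"
      unfolding ratio_def[symmetric]
      by (rule eventually_sequentiallyI[of 1], rule finite_measure_mono)
         (auto simp only: scaled_sum_eq, measurable)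
  qed auto
  show "(\<lambda>n. real (d n) * tail_mean (ratio n)) \<longlonglongrightarrow> 0"
    "(\<lambda>n. (real (d n))\<^sup>2 * trunc_sq_mean (ratio n) / real n) \<longlonglongrightarrow> 0"
    unfolding ratio_def
    using moment_conditions_of_lower_tail[OF d lower] by simp_all
qed

text \<open>Maclaurin's inequality, followed by \<open>\<mu> \<le> exp (\<mu> - 1)\<close> for the
  sample mean \<open>\<mu>\<close>.\<close>

lemma esym_ratio_le_exp:
  assumes n: "n \<ge> 1" and nonneg: "\<And>k. 0 \<le> Z k x"
  shows "esym_sum Z (d n) n x / real (n choose d n) \<le> exp (ratio n * (\<Sum>k=1..n. Z k x - 1))"
proof -
  define \<mu> where "\<mu> = (\<Sum>k=1..n. Z k x) / real n"
  have \<mu>: "0 \<le> \<mu>" using nonneg by (simp add: \<mu>_def sum_nonneg)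
  have "esym_sum Z (d n) n x \<le> real (n choose d n) * \<mu> ^ d n"
    using maclaurin_inequality[of "{1..n}" "\<lambda>i. Z i x" "d n"] nonneg
    by (simp add: esym_sum_eq_elem_sym \<mu>_def)
  then have "esym_sum Z (d n) n x / real (n choose d n) \<le> \<mu> ^ d n"
    using choose_pos[OF n] by (simp add: divide_le_eq mult.commute)
  also have "\<dots> \<le> exp (\<mu> - 1) ^ d n"
    using exp_ge_add_one_self[of "\<mu> - 1"] \<mu> by (intro power_mono) auto
  also have "\<dots> = exp (real (d n) * (\<mu> - 1))" by (simp add: exp_of_nat_mult)
  also have "real (d n) * (\<mu> - 1) = ratio n * (\<Sum>k=1..n. Z k x - 1)"
    unfolding \<mu>_def by (rule scaled_sum_eq[OF n])
  finally show ?thesis .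
qed

lemma moment_conditions_of_esym:
  assumes "tendsto_in_prob M (\<lambda>n x. esym_sum Z (d n) n x / real (n choose d n)) 1"
  shows "(\<lambda>n. real (d n) * tail_mean (ratio n)) \<longlonglongrightarrow> 0"
    and "(\<lambda>n. (real (d n))\<^sup>2 * trunc_sq_mean (ratio n) / real n) \<longlonglongrightarrow> 0"
proof -
  have lower: "(\<lambda>n. prob {x \<in> space M. real (d n) / real n * (\<Sum>k=1..n. Z k x - 1) < - \<epsilon>}) \<longlonglongrightarrow> 0"
    if \<epsilon>: "0 < \<epsilon>" for \<epsilon>
  proof (rule tendsto_sandwich[where f = "\<lambda>_. 0"])
    \<comment> \<open>By \<open>esym_ratio_le_exp\<close>, a scaled sum below
      \<open>- \<epsilon>\<close> puts the normalized symmetric sum below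
      \<open>exp (- \<epsilon>)\<close>, which is a deviation from 1 by more than
      \<open>1 - exp (- \<epsilon>)\<close>.\<close>
    show "(\<lambda>n. prob {x \<in> space M. \<bar>esym_sum Z (d n) n x / real (n choose d n) - 1\<bar> > 1 - exp (- \<epsilon>)}) \<longlonglongrightarrow> 0"
      using assms \<epsilon> unfolding tendsto_in_prob_def by simp
    show "\<forall>\<^sub>F n in sequentially. prob {x \<in> space M. real (d n) / real n * (\<Sum>k=1..n. Z k x - 1) < - \<epsilon>}
      \<le> prob {x \<in> space M. \<bar>esym_sum Z (d n) n x / real (n choose d n) - 1\<bar> > 1 - exp (- \<epsilon>)}"
      unfolding ratio_def[symmetric]
    proof (rule eventually_sequentiallyI[of 1], rule finite_measure_mono_AE)
      fix n :: nat assume n: "1 \<le> n"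
      show "AE x in M. x \<in> {x \<in> space M. ratio n * (\<Sum>k=1..n. Z k x - 1) < - \<epsilon>} \<longrightarrow>
        x \<in> {x \<in> space M. \<bar>esym_sum Z (d n) n x / real (n choose d n) - 1\<bar> > 1 - exp (- \<epsilon>)}"
        using AE_Z_all_nonneg
      proof eventually_elim
        case (elim x)
        show ?case
        proof safe
          assume "ratio n * (\<Sum>k=1..n. Z k x - 1) < - \<epsilon>"
          then have "exp (ratio n * (\<Sum>k=1..n. Z k x - 1)) < exp (- \<epsilon>)" by simp
          moreover have "esym_sum Z (d n) n x / real (n choose d n) \<le> exp (ratio n * (\<Sum>k=1..n. Z k x - 1))"
            using elim by (intro esym_ratio_le_exp[OF n]) auto
          ultimately show "1 - exp (- \<epsilon>) < \<bar>esym_sum Z (d n) n x / real (n choose d n) - 1\<bar>"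
            by linarith
        qed
      qed
    qed measurable
  qed auto
  show "(\<lambda>n. real (d n) * tail_mean (ratio n)) \<longlonglongrightarrow> 0"
    "(\<lambda>n. (real (d n))\<^sup>2 * trunc_sq_mean (ratio n) / real n) \<longlonglongrightarrow> 0"
    unfolding ratio_def
    using moment_conditions_of_lower_tail[OF d lower] by simp_all
qed

lemma scaled_sum_of_moment_conditions:
  assumes tail: "(\<lambda>n. real (d n) * tail_mean (ratio n)) \<longlonglongrightarrow> 0"
    and sq: "(\<lambda>n. (real (d n))\<^sup>2 * trunc_sq_mean (ratio n) / real n) \<longlonglongrightarrow> 0"
  shows "tendsto_in_prob M (\<lambda>n x. real (d n) * ((\<Sum>k=1..n. Z k x) / real n - 1)) 0"
proof (rule tendsto_in_probI)
  let ?U = "\<lambda>n x. ratio n * (\<Sum>k=1..n. trunc (ratio n) (Z k x) - 1)"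
  fix n :: nat
  show "?U n \<in> borel_measurable M" by measurable
  show "(\<lambda>x. real (d n) * ((\<Sum>k=1..n. Z k x) / real n - 1)) \<in> borel_measurable M" by measurable
  assume n: "1 \<le> n"
  have nr: "real n * ratio n = real (d n)" using n by (simp add: ratio_def)
  show "integrable M (\<lambda>x. \<bar>real (d n) * ((\<Sum>k=1..n. Z k x) / real n - 1) - ?U n x\<bar>)"
    unfolding scaled_sum_eq[OF n] by (rule integrable_sum_trunc_diff)
  show "integrable M (\<lambda>x. (?U n x - 0)\<^sup>2)"
    using integrable_sum_trunc_sq[OF ratio_pos[OF n]] by simp
  show "expectation (\<lambda>x. \<bar>real (d n) * ((\<Sum>k=1..n. Z k x) / real n - 1) - ?U n x\<bar>)
      \<le> real (d n) * tail_mean (ratio n)"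
    unfolding scaled_sum_eq[OF n] expectation_sum_trunc_diff[OF ratio_nonneg] using n by (simp add: ratio_def)
  have "expectation (\<lambda>x. (?U n x - 0)\<^sup>2)
      \<le> (ratio n)\<^sup>2 * (real n * trunc_sq_mean (ratio n) + (real n * tail_mean (ratio n))\<^sup>2)"
    using expectation_sum_trunc_sq_le[OF ratio_pos[OF n]] by simp
  also have "\<dots> = (real (d n))\<^sup>2 * trunc_sq_mean (ratio n) / real n + (real (d n) * tail_mean (ratio n))\<^sup>2"
    using n unfolding nr[symmetric] by (simp add: power2_eq_square algebra_simps)
  finally show "expectation (\<lambda>x. (?U n x - 0)\<^sup>2)
      \<le> (real (d n))\<^sup>2 * trunc_sq_mean (ratio n) / real n + (real (d n) * tail_mean (ratio n))\<^sup>2" .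
next
  show "(\<lambda>n. (real (d n))\<^sup>2 * trunc_sq_mean (ratio n) / real n + (real (d n) * tail_mean (ratio n))\<^sup>2) \<longlonglongrightarrow> 0"
    using tendsto_add[OF sq tendsto_power[OF tail, of 2]] by simp
qed (rule tail)

text \<open>Write \<open>\<tau>\<close> for \<open>tail_mean (ratio n)\<close> and \<open>W\<close>
  for the normalized truncated symmetric sum. Truncation lowers every product, so the mean error is
  \<open>1 - (1 - \<tau>) ^ d\<close>, at most \<open>d * \<tau>\<close> by Bernoulli. The second
  moment of \<open>W\<close> is at most the exponential of the expression in \<open>sq\<close>,
  while its mean is at least \<open>1 - d * \<tau>\<close>; thus \<open>W\<close> tends to 1 in mean
  square.\<close>

lemma esym_of_moment_conditions:
  assumes tail: "(\<lambda>n. real (d n) * tail_mean (ratio n)) \<longlonglongrightarrow> 0"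
    and sq: "(\<lambda>n. (real (d n))\<^sup>2 * trunc_sq_mean (ratio n) / real n) \<longlonglongrightarrow> 0"
  shows "tendsto_in_prob M (\<lambda>n x. esym_sum Z (d n) n x / real (n choose d n)) 1"
proof (rule tendsto_in_probI)
  let ?W = "\<lambda>n x. elem_sym {1..n} (\<lambda>i. trunc (ratio n) (Z i x)) (d n)"
  let ?C = "\<lambda>n. real (n choose d n)"
  let ?t = "\<lambda>n. real (d n) * tail_mean (ratio n)"
  let ?s = "\<lambda>n. (real (d n))\<^sup>2 * trunc_sq_mean (ratio n) / real n"
  fix n :: nat
  show "(\<lambda>x. ?W n x / ?C n) \<in> borel_measurable M" by measurable
  show "(\<lambda>x. esym_sum Z (d n) n x / ?C n) \<in> borel_measurable M" by measurable
  assume n: "1 \<le> n"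
  note C = choose_pos[OF n]
  note intS = integrable_elem_sym[of "\<lambda>z. z" n "d n"]
  note ES = expectation_elem_sym[of "\<lambda>z. z" n "d n"]
  have intW: "integrable M (?W n)" by (rule integrable_elem_sym[OF trunc_measurable integrable_trunc])
  have EW: "expectation (?W n) = ?C n * (1 - tail_mean (ratio n)) ^ d n"
    unfolding expectation_elem_sym[OF trunc_measurable integrable_trunc] expectation_trunc ..
  have p: "1 - ?t n \<le> (1 - tail_mean (ratio n)) ^ d n" by (rule one_minus_power_tail_mean)
  have diff: "integrable M (\<lambda>x. (esym_sum Z (d n) n x - ?W n x) / ?C n)"
    unfolding esym_sum_eq_elem_sym using intS intW Z_integrable by simp
  show "integrable M (\<lambda>x. \<bar>esym_sum Z (d n) n x / ?C n - ?W n x / ?C n\<bar>)"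
    using diff unfolding diff_divide_distrib[symmetric] by (rule integrable_abs)
  have "expectation (\<lambda>x. \<bar>esym_sum Z (d n) n x / ?C n - ?W n x / ?C n\<bar>)
      = expectation (\<lambda>x. (esym_sum Z (d n) n x - ?W n x) / ?C n)"
  proof (rule integral_cong_AE)
    show "AE x in M. \<bar>esym_sum Z (d n) n x / ?C n - ?W n x / ?C n\<bar> = (esym_sum Z (d n) n x - ?W n x) / ?C n"
      using AE_Z_all_nonneg
    proof eventually_elim
      case (elim x)
      have "?W n x \<le> esym_sum Z (d n) n x"
        unfolding esym_sum_eq_elem_sym using elim by (intro elem_sym_mono) (auto simp: trunc_def indicator_def)
      then show ?case by (simp add: diff_divide_distrib[symmetric])
    qed
  qed measurable
  also have "\<dots> = 1 - (1 - tail_mean (ratio n)) ^ d n"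
    using intS intW ES EW Z_integrable Z_mean C
    by (simp add: esym_sum_eq_elem_sym diff_divide_distrib)
  finally show "expectation (\<lambda>x. \<bar>esym_sum Z (d n) n x / ?C n - ?W n x / ?C n\<bar>) \<le> ?t n"
    using p by simp
  have e: "(?W n x / ?C n - 1)\<^sup>2 = (?W n x)\<^sup>2 / (?C n)\<^sup>2 - 2 * (?W n x / ?C n) + 1" for x
    by (simp add: power2_diff power_divide)
  note intW2 = integrable_elem_sym_trunc_sq[OF ratio_pos[OF n], of n "d n"]
  show "integrable M (\<lambda>x. (?W n x / ?C n - 1)\<^sup>2)"
    unfolding e using intW intW2 by simp
  have "expectation (\<lambda>x. (?W n x)\<^sup>2) / (?C n)\<^sup>2 \<le> (1 + trunc_sq_mean (ratio n) * real (d n) / real n) ^ d n"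
    using expectation_elem_sym_trunc_sq_le[OF ratio_pos[OF n], of n "d n"] C
    by (simp add: divide_le_eq mult.commute)
  also have "\<dots> \<le> exp (trunc_sq_mean (ratio n) * real (d n) / real n) ^ d n"
    using trunc_sq_mean_nonneg by (intro power_mono exp_ge_add_one_self) auto
  also have "\<dots> = exp (?s n)"
    by (simp add: exp_of_nat_mult[symmetric] power2_eq_square mult_ac)
  finally have W2: "expectation (\<lambda>x. (?W n x)\<^sup>2) / (?C n)\<^sup>2 \<le> exp (?s n)" .
  have "expectation (\<lambda>x. (?W n x / ?C n - 1)\<^sup>2)
      = expectation (\<lambda>x. (?W n x)\<^sup>2) / (?C n)\<^sup>2 - 2 * (1 - tail_mean (ratio n)) ^ d n + 1"
    unfolding e using intW intW2 EW C by (simp add: prob_space)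
  then show "expectation (\<lambda>x. (?W n x / ?C n - 1)\<^sup>2) \<le> exp (?s n) - 1 + 2 * ?t n"
    using W2 p by simp
next
  show "(\<lambda>n. exp ((real (d n))\<^sup>2 * trunc_sq_mean (ratio n) / real n) - 1 + 2 * (real (d n) * tail_mean (ratio n))) \<longlonglongrightarrow> 0"
    using tendsto_add[OF tendsto_diff[OF tendsto_exp[OF sq] tendsto_const[of 1]] tendsto_mult_left[OF tail, of 2]]
    by simp
qed (rule tail)

lemma tail_condition_iff:
  "(\<lambda>n. real (d n) * (LINT x|M. Z 0 x * indicator {x. real (d n) * Z 0 x > real n} x)) \<longlonglongrightarrow> 0
    \<longleftrightarrow> (\<lambda>n. real (d n) * tail_mean (ratio n)) \<longlonglongrightarrow> 0"
proof (rule tendsto_cong, rule eventually_sequentiallyI[of 1])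
  fix n :: nat assume "1 \<le> n"
  then have "real (d n) * z > real n \<longleftrightarrow> ratio n * z > 1" for z
    by (simp add: ratio_def field_simps)
  then show "real (d n) * (LINT x|M. Z 0 x * indicator {x. real (d n) * Z 0 x > real n} x)
      = real (d n) * tail_mean (ratio n)"
    by (simp add: tail_mean_def indicator_def)
qed

lemma trunc_sq_condition_iff:
  "(\<lambda>n. (real (d n))\<^sup>2 * (LINT x|M. (Z 0 x)\<^sup>2 * indicator {x. real (d n) * Z 0 x \<le> real n} x)) \<in> o(\<lambda>n. real n)
    \<longleftrightarrow> (\<lambda>n. (real (d n))\<^sup>2 * trunc_sq_mean (ratio n) / real n) \<longlonglongrightarrow> 0"
  (is "?f \<in> _ \<longleftrightarrow> _")
proof -
  have "?f \<in> o(\<lambda>n. real n) \<longleftrightarrow> (\<lambda>n. ?f n / real n) \<longlonglongrightarrow> 0"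
    by (auto intro!: smalloI_tendsto intro: eventually_sequentiallyI[of 1] dest: smalloD_tendsto)
  also have "\<dots> \<longleftrightarrow> (\<lambda>n. (real (d n))\<^sup>2 * trunc_sq_mean (ratio n) / real n) \<longlonglongrightarrow> 0"
  proof (rule tendsto_cong, rule eventually_sequentiallyI[of 1])
    fix n :: nat assume "1 \<le> n"
    then have "real (d n) * z \<le> real n \<longleftrightarrow> ratio n * z \<le> 1" for z
      by (simp add: ratio_def field_simps)
    then show "?f n / real n = (real (d n))\<^sup>2 * trunc_sq_mean (ratio n) / real n"
      by (simp add: trunc_sq_mean_def indicator_def)
  qed
  finally show ?thesis .
qed

end

end

theorem theorem2p4:
  fixes M :: "'a measure" and Z :: "nat \<Rightarrow> 'a \<Rightarrow> real" and d :: "nat \<Rightarrow> nat"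
  assumes "prob_space M"
    (* Z 0 is the generic copy Z, and Z 1, Z 2, ... is the sequence being summed *)
    and "iid M borel Z UNIV"
    and "\<And>k. AE x in M. 0 \<le> Z k x"
    and "nondegenerate M (Z 0)"
    and "integrable M (Z 0)" and "integral\<^sup>L M (Z 0) = 1"
    and "\<And>n. n \<ge> 1 \<Longrightarrow> d n \<in> {1..n}"
  defines "i \<equiv> tendsto_in_prob M (\<lambda>n x. esym_sum Z (d n) n x / real (n choose d n)) 1"
    and "ii \<equiv> tendsto_in_prob M (\<lambda>n x. real (d n) * ((\<Sum>k=1..n. Z k x) / real n - 1)) 0"
    and "iii \<equiv>
      (\<lambda>n. real (d n) *
        (LINT x|M. Z 0 x * indicator {x. real (d n) * Z 0 x > real n} x)) \<longlonglongrightarrow> 0 \<and>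
      (\<lambda>n. (real (d n))\<^sup>2 *
        (LINT x|M. (Z 0 x)\<^sup>2 * indicator {x. real (d n) * Z 0 x \<le> real n} x)) \<in> o(\<lambda>n. real n)"
  shows "(i \<longleftrightarrow> ii) \<and> (ii \<longleftrightarrow> iii)"
proof -
  interpret iid_unit_mean M Z
    by (intro iid_unit_mean.intro iid_unit_mean_axioms.intro assms)
  note d = assms(7)
  have "iii \<longleftrightarrow> (\<lambda>n. real (d n) * tail_mean (ratio d n)) \<longlonglongrightarrow> 0 \<and>
      (\<lambda>n. (real (d n))\<^sup>2 * trunc_sq_mean (ratio d n) / real n) \<longlonglongrightarrow> 0"
    unfolding iii_def by (intro arg_cong2[where f = "(\<and>)"] tail_condition_iff trunc_sq_condition_iff d)
  then show ?thesis
    using moment_conditions_of_esym[OF d] moment_conditions_of_scaled_sum[OF d]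
      esym_of_moment_conditions[OF d] scaled_sum_of_moment_conditions[OF d]
    unfolding i_def ii_def by blast
qed

end
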